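(* Let $\alpha\in(0,1]$, $\beta\in(0,2]$, $d\in\mathbb{Z}_+$, $r>0$ and $x_1,x_2\in B_r(0)\subset\mathbb{R}^d$. Assume that either (a) $\alpha\neq1$ and $1=d<\beta$, or (b) $\alpha=1$, $\beta\neq2$ and $d\in\mathbb{Z}_+$. Suppose $u$ is a mild solution in $[0,T]\times\mathbb{R}^d$ of the Cauchy problem $$\partial_t^\alpha(u-u_0)+(-\Delta)^{\beta/2}u=0,\qquad u(0,x)=u_0(x),$$ with nonnegative initial data $u_0$. Then for all $t_1,t_2$ satisfying $$(2r)^{\beta/\alpha}\le t_1<t_2\le t_1+(2r)^{\beta/\alpha}\le T$$ there exists a constant $C=C(t_2/t_1,\alpha,\beta,d)>0$ such that $$u(t_1,x_1)\le C\,u(t_2,x_2).$$ Moreover, when $\beta=2$, the constant $C$ blows up as $t_2\to t_1$.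
   Context: For $0<\alpha<1$, $\partial_t^\alpha$ is the Riemann-Liouville fractional derivative in time, $\partial_t^\alpha f(t)=\frac{d}{dt}\frac{1}{\Gamma(1-\alpha)}\int_0^t(t-\tau)^{-\alpha}f(\tau)\,d\tau$; for $\alpha=1$ it is the standard time derivative. $(-\Delta)^{\beta/2}$ acts in space as the Fourier multiplier with symbol $|\xi|^\beta$. $B_r(0)$ is the ball of radius $r$ centered at the origin. The mild solution of the Cauchy problem is the function $u(t,x)=\int_{\mathbb{R}^d}Z(t,x-y)u_0(y)\,dy$, whenever this integral is well defined. Here $Z$ is the fundamental solution, i.e. for each $t>0$ the probability density $Z(t,\cdot)$ on $\mathbb{R}^d$ (continuous on $\mathbb{R}^d\setminus\{0\}$) with Fourier transform $\widehat Z(t,\xi)=(2\pi)^{-d/2}E_\alpha(-|\xi|^\beta t^\alpha)$, where $\widehat f(\xi)=(2\pi)^{-d/2}\int_{\mathbb{R}^d}e^{-ix\cdot\xi}f(x)\,dx$ and $E_\alpha(z)=\sum_{k=0}^\infty z^k/\Gamma(1+\alpha k)$ is the Mittag-Leffler function. *)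

theory Defs
  imports "HOL-Analysis.Analysis"
begin

definition mittag_leffler :: "real \<Rightarrow> real \<Rightarrow> real" where
  "mittag_leffler \<alpha> z = (\<Sum>k. z ^ k / Gamma (1 + \<alpha> * real k))"

definition fourier_transform :: "(real ^ 'd \<Rightarrow> complex) \<Rightarrow> real ^ 'd \<Rightarrow> complex" where
  "fourier_transform f \<xi> =
     complex_of_real ((2 * pi) powr (- real CARD('d) / 2)) *
     (LINT x|lebesgue. exp (- \<i> * complex_of_real (x \<bullet> \<xi>)) * f x)"

text \<open>
  The fundamental solution is unique up to the value of each \<open>Z t\<close> at the origin, where the density
  may be unbounded; that value is left arbitrary, and no integral against \<open>Z t\<close> depends on it.
\<close>
definition fundamental_solution :: "real \<Rightarrow> real \<Rightarrow> (real \<Rightarrow> real ^ 'd \<Rightarrow> real) \<Rightarrow> bool" where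
  "fundamental_solution \<alpha> \<beta> Z \<longleftrightarrow>
     (\<forall>t>0. (\<forall>x. 0 \<le> Z t x) \<and>
            integrable lebesgue (Z t) \<and> (LINT x|lebesgue. Z t x) = 1 \<and>
            continuous_on (- {0}) (Z t) \<and>
            (\<forall>\<xi>. fourier_transform (\<lambda>x. complex_of_real (Z t x)) \<xi> =
                  complex_of_real ((2 * pi) powr (- real CARD('d) / 2) *
                    mittag_leffler \<alpha> (- (norm \<xi> powr \<beta> * t powr \<alpha>)))))"

text \<open>
  Mild solutions of the Cauchy problem
  \<open>\<partial>\<^sub>t\<^sup>\<alpha> (u - u0) + (-\<Delta>)\<^bsup>\<beta>/2\<^esup> u = 0\<close>, \<open>u 0 = u0\<close> on \<open>[0, T]\<close>, where \<open>Z\<close> is the fundamental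
  solution of the equation.
\<close>
definition mild_solution ::
  "(real \<Rightarrow> real ^ 'd \<Rightarrow> real) \<Rightarrow> real \<Rightarrow> (real ^ 'd \<Rightarrow> real) \<Rightarrow> (real \<Rightarrow> real ^ 'd \<Rightarrow> real) \<Rightarrow> bool" where
  "mild_solution Z T u0 u \<longleftrightarrow>
     (\<forall>x. u 0 x = u0 x) \<and>
     (\<forall>t x. 0 < t \<and> t \<le> T \<longrightarrow>
        integrable lebesgue (\<lambda>y. Z t (x - y) * u0 y) \<and>
        u t x = (LINT y|lebesgue. Z t (x - y) * u0 y))"

text \<open>
  \<open>C\<close> takes the ratio \<open>t2 / t1\<close> as its argument and is independent of all the data quantified here.
\<close>
definition harnack_constant ::
  "real \<Rightarrow> real \<Rightarrow> (real \<Rightarrow> real ^ 'd \<Rightarrow> real) \<Rightarrow> (real \<Rightarrow> real) \<Rightarrow> bool" where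
  "harnack_constant \<alpha> \<beta> Z C \<longleftrightarrow>
     (\<forall>r T x1 x2 u0 u t1 t2.
        0 < r \<longrightarrow> x1 \<in> ball 0 r \<longrightarrow> x2 \<in> ball 0 r \<longrightarrow>
        (\<forall>x. 0 \<le> u0 x) \<longrightarrow> mild_solution Z T u0 u \<longrightarrow>
        (2 * r) powr (\<beta> / \<alpha>) \<le> t1 \<longrightarrow> t1 < t2 \<longrightarrow>
        t2 \<le> t1 + (2 * r) powr (\<beta> / \<alpha>) \<longrightarrow> t1 + (2 * r) powr (\<beta> / \<alpha>) \<le> T \<longrightarrow>
        u t1 x1 \<le> C (t2 / t1) * u t2 x2)"

end

theory Submission
  imports Defs "HOL-Probability.Characteristic_Functions" "HOL-Real_Asymp.Real_Asymp"
begin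

text \<open>
  The density \<open>\<Phi> = Z 1\<close> determines the whole fundamental solution by self-similarity: with
  \<open>\<kappa> = \<alpha> / \<beta>\<close>, \<open>Z t x = t\<^bsup>-\<kappa>d\<^esup> \<Phi> (t\<^bsup>-\<kappa>\<^esup> x)\<close> for \<open>x \<noteq> 0\<close>. Suppose that \<open>\<Phi>\<close> is bounded, strictly
  positive and radially nonincreasing. In the self-similar variables the two points at which \<open>Z t1\<close>
  and \<open>Z t2\<close> are compared are \<open>z\<close> and \<open>w\<close> with \<open>|w| \<le> (|z| + 1) / \<sigma>\<close>, where
  \<open>\<sigma> = (t2 / t1)\<^bsup>\<kappa>\<^esup> > 1\<close>. The map \<open>r \<mapsto> (r + 1) / \<sigma>\<close> has the fixed point \<open>R = 1 / (\<sigma> - 1)\<close>. Beyond \<open>R\<close>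
  it decreases the radius, so \<open>\<Phi> z \<le> \<Phi> w\<close>; below \<open>R\<close> both radii stay at most \<open>R\<close>, so \<open>\<Phi> z\<close> is at
  most \<open>sup \<Phi>\<close> and \<open>\<Phi> w\<close> is at least the value of \<open>\<Phi>\<close> at radius \<open>R\<close> (\<open>harnack_kernel\<close>). Integrating
  against \<open>u0 \<ge> 0\<close> gives the Harnack inequality.

  The three properties of \<open>\<Phi>\<close> must be read off its Fourier transform
  \<open>E\<^sub>\<alpha> (- |\<xi>|\<^bsup>\<beta>\<^esup>) = h (|\<xi>|\<^sup>2)\<close>. The function \<open>h\<close> is completely monotone, so that \<open>\<Phi>\<close> is a mixture of
  centred Gaussians. The role of the mixing measure is taken by \<open>cm_on Y\<close>, the closure of
  the exponentials \<open>x \<mapsto> e\<^bsup>-sx\<^esup>\<close>, \<open>s \<ge> 0\<close>, under sums, nonnegative multiples and pointwise limits on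
  \<open>[-Y, \<infinity>)\<close>. A linear inequality between values of Gaussians that is uniform in the variance passes
  to every function of this cone after mollification (\<open>cm_transfer\<close>), and the mollification
  converges to \<open>\<Phi>\<close> off the origin (\<open>symbol_inversion\<close>). Monotonicity of Gaussians gives monotonicity
  of \<open>\<Phi>\<close>, an interpolation inequality between three radii gives positivity, and integrability of the
  symbol gives boundedness; here the two cases of the hypothesis are used, since \<open>E\<^sub>\<alpha> (- |\<xi>|\<^bsup>\<beta>\<^esup>)\<close>
  decays only like \<open>|\<xi>|\<^bsup>-\<beta>\<^esup>\<close> when \<open>\<alpha> < 1\<close>.

  That \<open>h\<close> lies in the cone has two ingredients. First, \<open>e\<^bsup>-s x^\<gamma>\<^esup>\<close> with \<open>0 < \<gamma> \<le> 1\<close> is the limit of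
  \<open>exp (- s ((1 - e\<^bsup>-\<theta>x\<^esup>) / \<theta>)\<^bsup>\<gamma>\<^esup>)\<close> as \<open>\<theta> \<rightarrow> 0\<close>, and \<open>1 - (1 - z)\<^bsup>\<gamma>\<^esup>\<close> has nonnegative Taylor coefficients.
  Secondly, \<open>E\<^sub>\<alpha> (- x)\<close> is the limit of the implicit convolution-quadrature scheme for the fractional
  relaxation equation, whose steps are nonnegative combinations of powers of \<open>1 / (1 + \<mu>)\<close>
  (\<open>resolvent_coeff_cm\<close>, \<open>resolvent_coeff_lim\<close>).

  For \<open>\<beta> = 2\<close> the symbol is \<open>E\<^sub>\<alpha> (- x)\<close> itself, which is entire and lies in \<open>cm_on Y\<close> for every \<open>Y\<close>.
  Therefore \<open>\<Phi>\<close> decays faster than every exponential (\<open>symbol_decay\<close>), and the ratio of \<open>\<Phi>\<close> at two radii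
  a fixed distance apart is unbounded. As \<open>t2 / t1 \<rightarrow> 1\<close> the Harnack inequality for indicators of small
  balls bounds such ratios by the constant, which must therefore tend to infinity.
\<close>

section \<open>The cone generated by decaying exponentials\<close>

text \<open>
  Up to the value at the endpoint \<open>- Y\<close>, this is the class of Laplace transforms on \<open>[-Y, \<infinity>)\<close> of
  positive measures on \<open>[0, \<infinity>)\<close>, presented by generators. Inequalities that are linear in the function and
  stable under limits need to be checked on exponentials only. A positive \<open>Y\<close> records exponential
  moments of the representing measure.
\<close>
inductive cm_on :: "real \<Rightarrow> (real \<Rightarrow> real) \<Rightarrow> bool" for Y :: real where
  cm_exp: "0 \<le> s \<Longrightarrow> cm_on Y (\<lambda>x. exp (- s * x))"
| cm_add: "cm_on Y f \<Longrightarrow> cm_on Y g \<Longrightarrow> cm_on Y (\<lambda>x. f x + g x)"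
| cm_scale: "0 \<le> c \<Longrightarrow> cm_on Y f \<Longrightarrow> cm_on Y (\<lambda>x. c * f x)"
| cm_lim: "(\<And>n. cm_on Y (f n)) \<Longrightarrow> (\<And>x. - Y \<le> x \<Longrightarrow> (\<lambda>n. f n x) \<longlonglongrightarrow> g x) \<Longrightarrow> cm_on Y g"

lemma cm_cong:
  assumes "cm_on Y f" "\<And>x. - Y \<le> x \<Longrightarrow> f x = g x"
  shows "cm_on Y g"
  by (rule cm_lim[where f = "\<lambda>_. f"]) (use assms in auto)

lemma cm_const: "0 \<le> c \<Longrightarrow> cm_on Y (\<lambda>_. c)"
  using cm_scale[OF _ cm_exp[of 0 Y], of c] by simp

lemma cm_sum:
  assumes "\<And>i. i \<in> A \<Longrightarrow> cm_on Y (f i)"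
  shows "cm_on Y (\<lambda>x. \<Sum>i\<in>A. f i x)"
  using assms
proof (induction A rule: infinite_finite_induct)
  case (insert i A)
  then show ?case by (simp add: cm_add)
qed (simp_all add: cm_const)

lemma cm_sums:
  assumes "\<And>n. cm_on Y (f n)" "\<And>x. - Y \<le> x \<Longrightarrow> (\<lambda>n. f n x) sums g x"
  shows "cm_on Y g"
  by (rule cm_lim[where f = "\<lambda>m x. \<Sum>n<m. f n x"])
     (use assms in \<open>auto intro!: cm_sum simp: sums_def\<close>)

lemma cm_mult_exp:
  assumes "cm_on Y f" "0 \<le> s"
  shows "cm_on Y (\<lambda>x. exp (- s * x) * f x)"
  using assms
proof (induction rule: cm_on.induct)
  case (cm_exp r)
  have "cm_on Y (\<lambda>x. exp (- (s + r) * x))"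
    using cm_exp by (intro cm_on.cm_exp) auto
  then show ?case by (simp add: exp_add[symmetric] algebra_simps)
next
  case (cm_add f g)
  show ?case unfolding distrib_left by (rule cm_on.cm_add) (use cm_add in auto)
next
  case (cm_scale c f)
  then show ?case using cm_on.cm_scale[of c Y "\<lambda>x. exp (- s * x) * f x"]
    by (simp add: mult.left_commute)
next
  case (cm_lim f g)
  then show ?case
    by - (rule cm_on.cm_lim[where f = "\<lambda>n x. exp (- s * x) * f n x"], auto intro: tendsto_mult_left)
qed

lemma cm_mult:
  assumes "cm_on Y f" "cm_on Y g"
  shows "cm_on Y (\<lambda>x. f x * g x)"
  using assms
proof (induction rule: cm_on.induct)
  case (cm_exp s)
  then show ?case using cm_mult_exp[of Y g s] by simp
next
  case (cm_add f f')
  show ?case unfolding distrib_right by (rule cm_on.cm_add) (use cm_add in auto)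
next
  case (cm_scale c f)
  show ?case unfolding mult.assoc by (rule cm_on.cm_scale) (use cm_scale in auto)
next
  case (cm_lim f h)
  then show ?case
    by - (rule cm_on.cm_lim[where f = "\<lambda>n x. f n x * g x"], auto intro: tendsto_mult_right)
qed

lemma cm_power: "cm_on Y f \<Longrightarrow> cm_on Y (\<lambda>x. f x ^ n)"
proof (induction n)
  case (Suc n)
  show ?case unfolding power_Suc by (rule cm_mult) (use Suc in auto)
qed (simp add: cm_const)

lemma cm_exp_of:
  assumes "cm_on Y f"
  shows "cm_on Y (\<lambda>x. exp (f x))"
proof (rule cm_sums)
  show "cm_on Y (\<lambda>x. (1 / fact n) * f x ^ n)" for n
    by (intro cm_scale cm_power assms) simp
  show "(\<lambda>n. 1 / fact n * f x ^ n) sums exp (f x)" for x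
    using exp_converges[of "f x"] by (simp add: divide_inverse)
qed

lemma cm_rescale:
  assumes "cm_on Y f" "0 \<le> c" "c * Y' \<le> Y"
  shows "cm_on Y' (\<lambda>x. f (c * x))"
  using assms
proof (induction rule: cm_on.induct)
  case (cm_exp s)
  then show ?case using cm_on.cm_exp[of "s * c" Y'] by (simp add: mult.assoc)
next
  case (cm_lim f g)
  have "- Y \<le> c * x" if "- Y' \<le> x" for x
    using mult_left_mono[OF that cm_lim.prems(1)] cm_lim.prems(2) by simp
  with cm_lim show ?case
    by - (rule cm_on.cm_lim[where f = "\<lambda>n x. f n (c * x)"], auto)
next
  case (cm_add f g)
  show ?case by (rule cm_on.cm_add) (use cm_add in auto)
next
  case (cm_scale a f)
  show ?case by (rule cm_on.cm_scale) (use cm_scale in auto)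
qed

lemma cm_shift:
  assumes "cm_on Y f" "0 \<le> \<delta>"
  shows "cm_on Y (\<lambda>x. f (x + \<delta>))"
  using assms
proof (induction rule: cm_on.induct)
  case (cm_exp s)
  have "cm_on Y (\<lambda>x. exp (- s * \<delta>) * exp (- s * x))"
    using cm_exp by (intro cm_scale cm_on.cm_exp) auto
  then show ?case by (simp add: exp_add[symmetric] algebra_simps)
next
  case (cm_lim f g)
  then show ?case
    by - (rule cm_on.cm_lim[where f = "\<lambda>n x. f n (x + \<delta>)"], auto)
next
  case (cm_add f g)
  show ?case by (rule cm_on.cm_add) (use cm_add in auto)
next
  case (cm_scale a f)
  show ?case by (rule cm_on.cm_scale) (use cm_scale in auto)
qed

lemma cm_nonneg:
  assumes "cm_on Y f" "- Y \<le> x"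
  shows "0 \<le> f x"
  using assms
proof (induction arbitrary: x rule: cm_on.induct)
  case (cm_lim f g)
  then show ?case by (intro LIMSEQ_le_const[of "\<lambda>n. f n x"]) auto
qed auto

lemma cm_antimono:
  assumes "cm_on Y f" "- Y \<le> x" "x \<le> y"
  shows "f y \<le> f x"
  using assms
proof (induction arbitrary: x y rule: cm_on.induct)
  case (cm_lim f g)
  then show ?case by (intro LIMSEQ_le[of "\<lambda>n. f n y" _ "\<lambda>n. f n x"]) auto
qed (auto intro: mult_left_mono add_mono)

lemma cm_measurable:
  assumes "cm_on 0 f" and [measurable]: "g \<in> borel_measurable M" and "\<And>x. 0 \<le> g x"
  shows "(\<lambda>x. f (g x)) \<in> borel_measurable M"
  using assms(1)
proof (induction rule: cm_on.induct)
  case (cm_lim f h)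
  show ?case
    by (rule borel_measurable_LIMSEQ_real[where u = "\<lambda>n x. f n (g x)"]) (use cm_lim assms in auto)
qed auto

lemma cm_weaken: "cm_on Y f \<Longrightarrow> Y' \<le> Y \<Longrightarrow> cm_on Y' f"
  using cm_rescale[of Y f 1 Y'] by simp

section \<open>Taylor coefficients of negative powers\<close>

text \<open>
  The coefficient of \<open>z\<^sup>n\<close> in \<open>(1 - z)\<^bsup>-b\<^esup>\<close>, see \<open>negpow_coeff_sums\<close>.
\<close>
definition negpow_coeff :: "real \<Rightarrow> nat \<Rightarrow> real" where
  "negpow_coeff b n = pochhammer b n / fact n"

lemma negpow_coeff_0 [simp]: "negpow_coeff b 0 = 1"
  by (simp add: negpow_coeff_def)

lemma negpow_coeff_1 [simp]: "negpow_coeff 1 n = 1"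
  by (simp add: negpow_coeff_def pochhammer_fact[symmetric])

lemma negpow_coeff_zero: "0 < n \<Longrightarrow> negpow_coeff 0 n = 0"
  by (simp add: negpow_coeff_def pochhammer_0_left)

lemma negpow_coeff_nonneg: "0 \<le> b \<Longrightarrow> 0 \<le> negpow_coeff b n"
  by (simp add: negpow_coeff_def pochhammer_nonneg zero_le_divide_iff) (auto simp: pochhammer_prod intro!: prod_nonneg)

lemma negpow_coeff_neg_nonpos:
  assumes "0 \<le> a" "a \<le> 1" "0 < n"
  shows "negpow_coeff (- a) n \<le> 0"
proof -
  obtain m where n: "n = Suc m" using assms(3) by (cases n) auto
  have "0 \<le> pochhammer (1 - a) m"
    unfolding pochhammer_prod using assms by (auto intro!: prod_nonneg)
  then have "(- a) * pochhammer (1 - a) m \<le> 0"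
    using assms by (simp add: mult_le_0_iff)
  then show ?thesis
    by (simp add: negpow_coeff_def n pochhammer_rec field_simps)
qed

lemma negpow_coeff_add: "(\<Sum>j\<le>n. negpow_coeff a j * negpow_coeff b (n - j)) = negpow_coeff (a + b) n"
proof -
  have "negpow_coeff (a + b) n = (\<Sum>j\<le>n. real (n choose j) * pochhammer a j * pochhammer b (n - j) / fact n)"
    unfolding negpow_coeff_def pochhammer_binomial_sum by (simp add: sum_divide_distrib)
  also have "\<dots> = (\<Sum>j\<le>n. negpow_coeff a j * negpow_coeff b (n - j))"
    by (intro sum.cong refl) (simp add: negpow_coeff_def binomial_fact field_simps)
  finally show ?thesis by simp
qed

lemma negpow_coeff_sums:
  fixes z :: real
  assumes "\<bar>z\<bar> < 1"
  shows "(\<lambda>n. negpow_coeff b n * z ^ n) sums (1 - z) powr (- b)"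
proof -
  have "((- b) gchoose n) * (- z) ^ n = negpow_coeff b n * z ^ n" for n
    by (simp add: negpow_coeff_def gbinomial_pochhammer power_minus[of z] mult.assoc)
  with gen_binomial_real[of "- z" "- b"] assms show ?thesis
    by (simp add: powr_minus)
qed

lemma negpow_coeff_mono:
  assumes "0 \<le> x" "n \<le> m"
  shows "negpow_coeff (1 + x) n \<le> negpow_coeff (1 + x) m"
proof -
  have "negpow_coeff (1 + x) (Suc k) = negpow_coeff (1 + x) k * ((1 + x + real k) / real (Suc k))" for k
    by (simp add: negpow_coeff_def pochhammer_Suc field_simps)
  moreover have "1 \<le> (1 + x + real k) / real (Suc k)" for k
    using assms(1) by simp
  ultimately have "negpow_coeff (1 + x) k \<le> negpow_coeff (1 + x) (Suc k)" for k
    using negpow_coeff_nonneg[of "1 + x" k] assms(1) mult_left_mono[of 1 _ "negpow_coeff (1 + x) k"] by fastforce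
  then show ?thesis using assms(2) by (rule lift_Suc_mono_le)
qed

text \<open>
  The coefficients of \<open>(1 - z)\<^bsup>-1-x\<^esup>\<close> are nonnegative and nondecreasing, so \<open>(1 - \<rho>)\<^bsup>-1-x\<^esup>\<close>
  dominates the geometric tail that starts at index \<open>n\<close>. Using the whole tail instead of one term
  gains a factor \<open>1 - \<rho>\<close>, which is what keeps the bound uniform in \<open>n\<close> when \<open>1 - \<rho>\<close> is of order \<open>1 / n\<close>.
\<close>
lemma negpow_coeff_bound:
  assumes "0 \<le> x" "0 < \<rho>" "\<rho> < 1"
  shows "negpow_coeff (1 + x) n \<le> (1 / \<rho>) ^ n * (1 - \<rho>) powr (- x)"
proof -
  have s: "(\<lambda>m. negpow_coeff (1 + x) m * \<rho> ^ m) sums (1 - \<rho>) powr (- (1 + x))"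
    using assms by (intro negpow_coeff_sums) auto
  have g: "(\<lambda>m. negpow_coeff (1 + x) n * \<rho> ^ n * \<rho> ^ m) sums (negpow_coeff (1 + x) n * \<rho> ^ n * (1 / (1 - \<rho>)))"
    using assms by (intro sums_mult geometric_sums) auto
  have "(\<lambda>m. negpow_coeff (1 + x) (m + n) * \<rho> ^ (m + n)) sums
      ((1 - \<rho>) powr (- (1 + x)) - (\<Sum>m<n. negpow_coeff (1 + x) m * \<rho> ^ m))"
    using s by (rule sums_split_initial_segment)
  then have "negpow_coeff (1 + x) n * \<rho> ^ n * (1 / (1 - \<rho>))
      \<le> (1 - \<rho>) powr (- (1 + x)) - (\<Sum>m<n. negpow_coeff (1 + x) m * \<rho> ^ m)"
    using assms by (intro sums_le[OF _ g])
      (auto simp: power_add mult.assoc mult.commute[of "\<rho> ^ n"] intro!: mult_right_mono negpow_coeff_mono)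
  also have "\<dots> \<le> (1 - \<rho>) powr (- (1 + x))"
    using assms by (auto intro!: sum_nonneg mult_nonneg_nonneg negpow_coeff_nonneg)
  also have "\<dots> = (1 - \<rho>) powr (- x) / (1 - \<rho>)"
    using assms by (simp add: powr_diff powr_minus powr_add field_simps)
  finally have "negpow_coeff (1 + x) n * \<rho> ^ n \<le> (1 - \<rho>) powr (- x)"
    using assms by (simp add: divide_right_mono_neg divide_le_cancel)
  then show ?thesis using assms by (simp add: power_divide field_simps)
qed

text \<open>
  This is Euler's limit formula for the reciprocal Gamma function.
\<close>
lemma negpow_coeff_lim:
  assumes "0 \<le> x"
  shows "(\<lambda>n. negpow_coeff (1 + x) n * real n powr (- x)) \<longlonglongrightarrow> 1 / Gamma (1 + x)"
proof -
  have G: "rGamma_series (1 + x) \<longlonglongrightarrow> rGamma (1 + x)"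
    by (rule rGamma_series_LIMSEQ)
  have q: "(\<lambda>n. real n / (1 + x + real n)) \<longlonglongrightarrow> 1"
    by real_asymp
  have "(\<lambda>n. rGamma_series (1 + x) n * (real n / (1 + x + real n))) \<longlonglongrightarrow> rGamma (1 + x) * 1"
    by (intro tendsto_mult G q)
  moreover have "\<forall>\<^sub>F n in sequentially.
      rGamma_series (1 + x) n * (real n / (1 + x + real n)) = negpow_coeff (1 + x) n * real n powr (- x)"
    using eventually_gt_at_top[of 0]
  proof eventually_elim
    case (elim n)
    have "exp ((1 + x) * of_real (ln (of_nat n))) = real n * real n powr x"
      using elim by (simp add: powr_def exp_add algebra_simps)
    then show ?case using elim assms
      by (simp add: rGamma_series_def negpow_coeff_def pochhammer_Suc powr_minus divide_simps)
  qed
  ultimately have "(\<lambda>n. negpow_coeff (1 + x) n * real n powr (- x)) \<longlonglongrightarrow> rGamma (1 + x)"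
    by (simp add: tendsto_cong)
  then show ?thesis by (simp add: rGamma_inverse_Gamma divide_inverse)
qed

section \<open>Powers inside completely monotone functions\<close>

text \<open>
  The function \<open>p x = 1 - (1 - e\<^bsup>-x\<^esup>)\<^bsup>\<gamma>\<^esup>\<close> is a nonnegative combination of \<open>e\<^bsup>-jx\<^esup>\<close>, by the binomial
  series. Hence \<open>e\<^bsup>-c\<^esup> e\<^bsup>c p\<^esup>\<close> is in the cone for every \<open>c \<ge> 0\<close>, and rescaling \<open>x\<close> turns it into an
  approximation of \<open>e\<^bsup>-s x^\<gamma>\<^esup>\<close>.
\<close>
lemma cm_exp_neg_powr:
  assumes "0 < \<gamma>" "\<gamma> \<le> 1" "0 \<le> s"
  shows "cm_on 0 (\<lambda>x. exp (- s * x powr \<gamma>))"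
proof -
  have w: "cm_on 0 (\<lambda>x. 1 - (1 - exp (- (x + \<delta>))) powr \<gamma>)" if "0 < \<delta>" for \<delta> :: real
  proof (rule cm_sums)
    fix x :: real assume x: "- 0 \<le> x"
    have "(\<lambda>n. negpow_coeff (- \<gamma>) n * exp (- (x + \<delta>)) ^ n) sums (1 - exp (- (x + \<delta>))) powr (- (- \<gamma>))"
      using x that by (intro negpow_coeff_sums) auto
    from sums_split_initial_segment[OF this, of 1]
    have "(\<lambda>n. negpow_coeff (- \<gamma>) (Suc n) * exp (- (x + \<delta>)) ^ Suc n) sums ((1 - exp (- (x + \<delta>))) powr \<gamma> - 1)"
      by simp
    from sums_minus[OF this]
    show "(\<lambda>n. - negpow_coeff (- \<gamma>) (Suc n) * exp (- (x + \<delta>)) ^ Suc n) sums (1 - (1 - exp (- (x + \<delta>))) powr \<gamma>)"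
      by simp
  next
    fix n
    show "cm_on 0 (\<lambda>x. - negpow_coeff (- \<gamma>) (Suc n) * exp (- (x + \<delta>)) ^ Suc n)"
    proof (rule cm_scale)
      show "0 \<le> - negpow_coeff (- \<gamma>) (Suc n)" using negpow_coeff_neg_nonpos[of \<gamma> "Suc n"] assms by simp
      show "cm_on 0 (\<lambda>x. exp (- (x + \<delta>)) ^ Suc n)"
        using cm_shift[OF cm_power[OF cm_exp[of 1 0]], of \<delta> "Suc n"] that by simp
    qed
  qed
  \<comment> \<open>The binomial series is summed only inside its disc of convergence; the endpoint \<open>x = 0\<close> is
    reached by letting the shift \<open>\<delta>\<close> tend to \<open>0\<close>.\<close>
  have p: "cm_on 0 (\<lambda>x. 1 - (1 - exp (- x)) powr \<gamma>)"
  proof (rule cm_lim)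
    show "cm_on 0 (\<lambda>x. 1 - (1 - exp (- (x + inverse (real (Suc n))))) powr \<gamma>)" for n
      by (rule w) simp
    fix x :: real assume x: "- 0 \<le> x"
    have "(\<lambda>n. 1 - (1 - exp (- (x + inverse (real (Suc n))))) powr \<gamma>) \<longlonglongrightarrow> 1 - (1 - exp (- (x + 0))) powr \<gamma>"
      using x assms
      by (intro tendsto_intros tendsto_powr2 LIMSEQ_inverse_real_of_nat always_eventually) auto
    then show "(\<lambda>n. 1 - (1 - exp (- (x + inverse (real (Suc n))))) powr \<gamma>) \<longlonglongrightarrow> 1 - (1 - exp (- x)) powr \<gamma>"
      by simp
  qed
  have q: "cm_on 0 (\<lambda>x. exp (- s * ((1 - exp (- \<theta> * x)) / \<theta>) powr \<gamma>))" if "0 < \<theta>" for \<theta> :: real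
  proof -
    let ?c = "s * \<theta> powr (- \<gamma>)"
    have "cm_on 0 (\<lambda>x. exp (- ?c) * exp (?c * (1 - (1 - exp (- (\<theta> * x))) powr \<gamma>)))"
      using assms that
      by (intro cm_on.cm_scale cm_exp_of cm_rescale[OF p]) auto
    then show ?thesis
    proof (rule cm_cong)
      fix x :: real assume "- 0 \<le> x"
      then have "0 \<le> 1 - exp (- (\<theta> * x))" using that by simp
      then show "exp (- ?c) * exp (?c * (1 - (1 - exp (- (\<theta> * x))) powr \<gamma>))
          = exp (- s * ((1 - exp (- \<theta> * x)) / \<theta>) powr \<gamma>)"
        using that by (simp add: exp_add[symmetric] powr_divide powr_minus field_simps)
    qed
  qed
  show ?thesis
  proof (rule cm_lim)
    show "cm_on 0 (\<lambda>x. exp (- s * ((1 - exp (- inverse (real (Suc n)) * x)) / inverse (real (Suc n))) powr \<gamma>))" for n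
      by (rule q) simp
    fix x :: real assume x: "- 0 \<le> x"
    have "((\<lambda>\<theta>. (1 - exp (- \<theta> * x)) / \<theta>) \<longlongrightarrow> x) (at_right 0)"
      by real_asymp
    moreover have "filterlim (\<lambda>n. inverse (real (Suc n))) (at_right 0) sequentially"
      by real_asymp
    ultimately have "(\<lambda>n. (1 - exp (- inverse (real (Suc n)) * x)) / inverse (real (Suc n))) \<longlonglongrightarrow> x"
      by (rule filterlim_compose)
    then show "(\<lambda>n. exp (- s * ((1 - exp (- inverse (real (Suc n)) * x)) / inverse (real (Suc n))) powr \<gamma>))
        \<longlonglongrightarrow> exp (- s * x powr \<gamma>)"
      using x assms by (intro tendsto_intros tendsto_powr2 always_eventually) auto
  qed
qed

text \<open>
  This is subordination: composition with \<open>x\<^bsup>\<gamma>\<^esup>\<close> commutes with the operations of the cone, so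
  the exponentials decide.
\<close>
lemma cm_compose_powr:
  assumes "cm_on 0 f" "0 < \<gamma>" "\<gamma> \<le> 1"
  shows "cm_on 0 (\<lambda>x. f (x powr \<gamma>))"
  using assms(1)
proof (induction rule: cm_on.induct)
  case (cm_exp s)
  show ?case by (rule cm_exp_neg_powr) (use assms cm_exp in auto)
next
  case (cm_add f g)
  show ?case by (rule cm_on.cm_add) (use cm_add in auto)
next
  case (cm_scale a f)
  show ?case by (rule cm_on.cm_scale) (use cm_scale in auto)
next
  case (cm_lim f g)
  show ?case by (rule cm_on.cm_lim[where f = "\<lambda>n x. f n (x powr \<gamma>)"]) (use cm_lim in auto)
qed

section \<open>Complete monotonicity of the Mittag-Leffler function\<close>

text \<open>
  Riemann sums of \<open>\<integral> e\<^bsup>-s(1 + x)\<^esup> ds\<close> over \<open>s \<ge> 0\<close> are geometric series in closed form.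
\<close>
lemma cm_inverse:
  assumes "Y < 1"
  shows "cm_on Y (\<lambda>x. 1 / (1 + x))"
proof (rule cm_lim)
  fix n
  let ?h = "inverse (real (Suc n))"
  show "cm_on Y (\<lambda>x. ?h * (1 / (1 - exp (- ?h * (1 + x)))))"
  proof (rule cm_scale[OF _ cm_sums])
    fix j
    have "cm_on Y (\<lambda>x. exp (- ?h * real j) * exp (- (?h * real j) * x))"
      by (intro cm_scale cm_exp) auto
    then show "cm_on Y (\<lambda>x. exp (- ?h * (1 + x)) ^ j)"
      by (simp add: exp_of_nat_mult[symmetric] exp_add[symmetric] algebra_simps)
    fix x assume "- Y \<le> x"
    with assms show "(\<lambda>j. exp (- ?h * (1 + x)) ^ j) sums (1 / (1 - exp (- ?h * (1 + x))))"
      by (intro geometric_sums) auto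
  qed simp
next
  fix x assume "- Y \<le> x"
  then have "0 < 1 + x" using assms by simp
  then show "(\<lambda>n. inverse (real (Suc n)) * (1 / (1 - exp (- inverse (real (Suc n)) * (1 + x))))) \<longlonglongrightarrow> 1 / (1 + x)"
    unfolding inverse_eq_divide[of "1 + x", symmetric] by real_asymp
qed

lemma negpow_coeff_le:
  assumes "0 \<le> a" "a \<le> b"
  shows "negpow_coeff a n \<le> negpow_coeff b n"
  unfolding negpow_coeff_def pochhammer_prod
  using assms by (intro divide_right_mono prod_mono) auto

lemma negpow_coeff_Suc_diff: "negpow_coeff b (Suc n) - negpow_coeff b n = negpow_coeff (b - 1) (Suc n)"
proof -
  have "negpow_coeff b (Suc n) - negpow_coeff b n = negpow_coeff b n * ((b + real n) / real (Suc n)) - negpow_coeff b n * 1"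
    by (simp add: negpow_coeff_def pochhammer_Suc field_simps)
  also have "\<dots> = negpow_coeff b n * ((b + real n) / real (Suc n) - 1)"
    by (rule right_diff_distrib[symmetric])
  also have "(b + real n) / real (Suc n) - 1 = (b - 1) / real (Suc n)"
    by (simp add: field_simps)
  also have "negpow_coeff b n * ((b - 1) / real (Suc n)) = negpow_coeff (b - 1) (Suc n)"
    by (simp add: negpow_coeff_def pochhammer_rec field_simps)
  finally show ?thesis .
qed

text \<open>
  For \<open>|\<mu>| < 1\<close> this is the coefficient of \<open>z\<^sup>n\<close> in \<open>(1 - z)\<^bsup>-b\<^esup> / (1 + \<mu> (1 - z)\<^bsup>-\<alpha>\<^esup>)\<close>. For \<open>b = 1\<close> it is
  the \<open>n\<close>-th step of the backward Euler convolution quadrature for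
  \<open>\<partial>\<^sub>t\<^sup>\<alpha> (v - 1) + \<lambda> v = 0\<close> with step size \<open>\<tau>\<close> and \<open>\<mu> = \<lambda> \<tau>\<^bsup>\<alpha>\<^esup>\<close>.
\<close>
definition resolvent_coeff :: "real \<Rightarrow> real \<Rightarrow> nat \<Rightarrow> real \<Rightarrow> real" where
  "resolvent_coeff \<alpha> b n \<mu> = (\<Sum>k. (- \<mu>) ^ k * negpow_coeff (b + \<alpha> * real k) n)"

lemma resolvent_coeff_summable:
  assumes "0 < \<alpha>" "0 \<le> b" "b \<le> 1" "\<bar>\<mu>\<bar> < 1"
  shows "summable (\<lambda>k. (- \<mu>) ^ k * negpow_coeff (b + \<alpha> * real k) n)"
proof -
  \<comment> \<open>Any \<open>q\<close> strictly between \<open>|\<mu>|\<close> and \<open>1\<close> works; \<open>\<rho>\<close> is chosen with \<open>(1 - \<rho>)\<^bsup>\<alpha>\<^esup> = q\<close>.\<close>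
  define q where "q = (1 + \<bar>\<mu>\<bar>) / 2"
  have q: "\<bar>\<mu>\<bar> < q" "0 < q" "q < 1" using assms(4) by (auto simp: q_def)
  define \<rho> where "\<rho> = 1 - q powr (1 / \<alpha>)"
  have \<rho>: "0 < \<rho>" "\<rho> < 1"
    using q assms(1) powr_less_mono2[of "1 / \<alpha>" q 1] by (auto simp: \<rho>_def)
  have bound: "norm ((- \<mu>) ^ k * negpow_coeff (b + \<alpha> * real k) n) \<le> (1 / \<rho>) ^ n * (\<bar>\<mu>\<bar> / q) ^ k" for k
  proof -
    have "(1 - \<rho>) powr (- (\<alpha> * real k)) = q powr (- real k)"
      unfolding \<rho>_def using assms(1) by (simp add: powr_powr)
    also have "\<dots> = (1 / q) ^ k"
      using q(2) by (simp add: powr_minus powr_realpow power_one_over inverse_eq_divide)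
    finally have e: "(1 - \<rho>) powr (- (\<alpha> * real k)) = (1 / q) ^ k" .
    have "negpow_coeff (b + \<alpha> * real k) n \<le> negpow_coeff (1 + \<alpha> * real k) n"
      using assms by (intro negpow_coeff_le) auto
    also have "\<dots> \<le> (1 / \<rho>) ^ n * (1 / q) ^ k"
      unfolding e[symmetric] using assms \<rho> by (intro negpow_coeff_bound) auto
    finally have le: "negpow_coeff (b + \<alpha> * real k) n \<le> (1 / \<rho>) ^ n * (1 / q) ^ k" .
    have "0 \<le> negpow_coeff (b + \<alpha> * real k) n" using assms by (intro negpow_coeff_nonneg) auto
    then have "norm ((- \<mu>) ^ k * negpow_coeff (b + \<alpha> * real k) n) = \<bar>\<mu>\<bar> ^ k * negpow_coeff (b + \<alpha> * real k) n"
      by (simp add: abs_mult power_abs)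
    also have "\<dots> \<le> \<bar>\<mu>\<bar> ^ k * ((1 / \<rho>) ^ n * (1 / q) ^ k)"
      using le by (rule mult_left_mono) simp
    also have "\<dots> = (1 / \<rho>) ^ n * (\<bar>\<mu>\<bar> / q) ^ k"
      by (simp add: power_divide)
    finally show ?thesis .
  qed
  have "summable (\<lambda>k. (1 / \<rho>) ^ n * (\<bar>\<mu>\<bar> / q) ^ k)"
    using q by (intro summable_mult summable_geometric) auto
  then show ?thesis
    by (rule summable_comparison_test'[where N = 0]) (rule bound)
qed

text \<open>
  Multiplication of the generating function by \<open>(1 - z)\<^bsup>-a\<^esup>\<close> shifts \<open>b\<close> to \<open>a + b\<close>.
\<close>
lemma resolvent_coeff_convolution:
  assumes "0 < \<alpha>" "0 \<le> b" "b \<le> 1" "\<bar>\<mu>\<bar> < 1"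
  shows "(\<lambda>k. (- \<mu>) ^ k * negpow_coeff (a + b + \<alpha> * real k) n) sums (\<Sum>j\<le>n. negpow_coeff a j * resolvent_coeff \<alpha> b (n - j) \<mu>)"
proof -
  have "(\<lambda>k. \<Sum>j\<le>n. negpow_coeff a j * ((- \<mu>) ^ k * negpow_coeff (b + \<alpha> * real k) (n - j))) sums
      (\<Sum>j\<le>n. negpow_coeff a j * resolvent_coeff \<alpha> b (n - j) \<mu>)"
    unfolding resolvent_coeff_def
    by (intro sums_sum sums_mult summable_sums resolvent_coeff_summable assms)
  moreover have "(\<Sum>j\<le>n. negpow_coeff a j * ((- \<mu>) ^ k * negpow_coeff (b + \<alpha> * real k) (n - j)))
      = (- \<mu>) ^ k * negpow_coeff (a + b + \<alpha> * real k) n" for k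
    using negpow_coeff_add[of a "b + \<alpha> * real k" n]
    by (simp add: mult.left_commute[of _ "(- \<mu>) ^ k"] sum_distrib_left[symmetric] add.assoc)
  ultimately show ?thesis by simp
qed

text \<open>
  Compare coefficients in \<open>((1 - z)\<^bsup>\<alpha>\<^esup> + \<mu>) G = (1 - z)\<^bsup>\<alpha>-b\<^esup>\<close>, where \<open>G\<close> is the generating
  function, and solve for the coefficient of index \<open>n\<close>.
\<close>
lemma resolvent_coeff_rec:
  assumes "0 < \<alpha>" "0 \<le> b" "b \<le> 1" "\<bar>\<mu>\<bar> < 1"
  shows "resolvent_coeff \<alpha> b n \<mu> =
    (negpow_coeff (b - \<alpha>) n + (\<Sum>j\<in>{1..n}. - negpow_coeff (- \<alpha>) j * resolvent_coeff \<alpha> b (n - j) \<mu>)) * (1 / (1 + \<mu>))"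
proof -
  let ?S = "resolvent_coeff \<alpha> b"
  have "(\<lambda>k. (- \<mu>) ^ Suc k * negpow_coeff (- \<alpha> + b + \<alpha> * real (Suc k)) n) sums
      ((\<Sum>j\<le>n. negpow_coeff (- \<alpha>) j * ?S (n - j) \<mu>) - negpow_coeff (b - \<alpha>) n)"
    using sums_split_initial_segment[OF resolvent_coeff_convolution[OF assms, of "- \<alpha>" n], of 1]
    by (simp add: add.commute)
  moreover have "(\<lambda>k. (- \<mu>) ^ Suc k * negpow_coeff (- \<alpha> + b + \<alpha> * real (Suc k)) n) sums (- \<mu> * ?S n \<mu>)"
    using sums_mult[OF summable_sums[OF resolvent_coeff_summable[OF assms, of n]], of "- \<mu>"]
    by (simp add: resolvent_coeff_def algebra_simps)
  ultimately have "(\<Sum>j\<le>n. negpow_coeff (- \<alpha>) j * ?S (n - j) \<mu>) - negpow_coeff (b - \<alpha>) n = - \<mu> * ?S n \<mu>"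
    by (rule sums_unique2)
  moreover have "(\<Sum>j\<le>n. negpow_coeff (- \<alpha>) j * ?S (n - j) \<mu>) =
      ?S n \<mu> + (\<Sum>j\<in>{1..n}. negpow_coeff (- \<alpha>) j * ?S (n - j) \<mu>)"
    by (simp add: atMost_atLeast0 sum.atLeast_Suc_atMost)
  ultimately have eq: "?S n \<mu> * (1 + \<mu>) = negpow_coeff (b - \<alpha>) n + (\<Sum>j\<in>{1..n}. - negpow_coeff (- \<alpha>) j * ?S (n - j) \<mu>)"
    by (simp add: algebra_simps sum_negf)
  have "1 + \<mu> \<noteq> 0" using assms(4) by linarith
  from nonzero_eq_divide_eq[THEN iffD2, OF this eq] show ?thesis
    by (simp only: times_divide_eq_right mult_1_right)
qed

text \<open>
  In the recursion all weights \<open>- negpow_coeff (- \<alpha>) j\<close> are nonnegative because \<open>\<alpha> \<le> 1\<close>, and the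
  factor \<open>1 / (1 + \<mu>)\<close> is in the cone. The recursion extends the series from \<open>|\<mu>| < 1\<close> to \<open>\<mu> \<ge> - Y\<close>,
  which is why the conclusion is phrased with an extension \<open>f\<close>.
\<close>
lemma resolvent_coeff_cm:
  assumes "0 < \<alpha>" "\<alpha> \<le> 1" "\<And>n. 0 \<le> negpow_coeff (b - \<alpha>) n" "0 \<le> b" "b \<le> 1" "Y < 1"
  shows "\<exists>f. cm_on Y f \<and> (\<forall>\<mu>. \<bar>\<mu>\<bar> < 1 \<longrightarrow> f \<mu> = resolvent_coeff \<alpha> b n \<mu>)"
proof (induction n rule: less_induct)
  case (less n)
  then have "\<forall>m. \<exists>f. m < n \<longrightarrow> cm_on Y f \<and> (\<forall>\<mu>. \<bar>\<mu>\<bar> < 1 \<longrightarrow> f \<mu> = resolvent_coeff \<alpha> b m \<mu>)"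
    by blast
  then obtain F where F: "\<And>m. m < n \<Longrightarrow> cm_on Y (F m)"
    "\<And>m \<mu>. m < n \<Longrightarrow> \<bar>\<mu>\<bar> < 1 \<Longrightarrow> F m \<mu> = resolvent_coeff \<alpha> b m \<mu>"
    using choice[of "\<lambda>m f. m < n \<longrightarrow> cm_on Y f \<and> (\<forall>\<mu>. \<bar>\<mu>\<bar> < 1 \<longrightarrow> f \<mu> = resolvent_coeff \<alpha> b m \<mu>)"] by blast
  let ?f = "\<lambda>\<mu>. (negpow_coeff (b - \<alpha>) n + (\<Sum>j\<in>{1..n}. - negpow_coeff (- \<alpha>) j * F (n - j) \<mu>)) * (1 / (1 + \<mu>))"
  have "cm_on Y ?f"
  proof (rule cm_mult[OF cm_add[OF cm_const cm_sum] cm_inverse])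
    fix j assume j: "j \<in> {1..n}"
    show "cm_on Y (\<lambda>\<mu>. - negpow_coeff (- \<alpha>) j * F (n - j) \<mu>)"
      by (rule cm_scale) (use j assms negpow_coeff_neg_nonpos[of \<alpha> j] F(1) in auto)
  qed (use assms in auto)
  moreover have "?f \<mu> = resolvent_coeff \<alpha> b n \<mu>" if "\<bar>\<mu>\<bar> < 1" for \<mu>
  proof -
    have "(\<Sum>j\<in>{1..n}. - negpow_coeff (- \<alpha>) j * F (n - j) \<mu>) = (\<Sum>j\<in>{1..n}. - negpow_coeff (- \<alpha>) j * resolvent_coeff \<alpha> b (n - j) \<mu>)"
      using that by (intro sum.cong refl) (auto simp: F(2))
    then show ?thesis
      by (simp only: resolvent_coeff_rec[OF assms(1,4,5) that, of n])
  qed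
  ultimately show ?case by (intro exI[of _ ?f] conjI allI impI)
qed

lemma resolvent_coeff_nonneg:
  assumes "0 < \<alpha>" "\<alpha> \<le> 1" "\<And>n. 0 \<le> negpow_coeff (b - \<alpha>) n" "0 \<le> b" "b \<le> 1" "0 \<le> \<mu>" "\<mu> < 1"
  shows "0 \<le> resolvent_coeff \<alpha> b n \<mu>"
proof -
  obtain f where "cm_on 0 f" "\<And>\<mu>. \<bar>\<mu>\<bar> < 1 \<Longrightarrow> f \<mu> = resolvent_coeff \<alpha> b n \<mu>"
    using resolvent_coeff_cm[OF assms(1-5), of 0 n] by auto
  then show ?thesis using cm_nonneg[of 0 f \<mu>] assms(6,7) by simp
qed

text \<open>
  The discrete solution \<open>v\<close> of the relaxation equation satisfies \<open>v\<^sub>n + \<mu> (w * v)\<^sub>n = 1\<close> with a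
  nonnegative kernel \<open>w\<close>, and it is nonincreasing in \<open>n\<close>. Therefore the convolution is at least
  \<open>v\<^sub>n\<close> times the sum of the first \<open>n + 1\<close> kernel weights.
\<close>
lemma resolvent_coeff_bound:
  assumes "0 < \<alpha>" "\<alpha> \<le> 1" "0 \<le> \<mu>" "\<mu> < 1"
  shows "\<mu> * negpow_coeff (1 + \<alpha>) n * resolvent_coeff \<alpha> 1 n \<mu> \<le> 1"
proof -
  let ?S = "\<lambda>n. resolvent_coeff \<alpha> 1 n \<mu>"
  have \<mu>: "\<bar>\<mu>\<bar> < 1" using assms by simp
  have mono: "?S (Suc n) \<le> ?S n" for n
  proof -
    have "(\<lambda>k. (- \<mu>) ^ k * negpow_coeff (1 + \<alpha> * real k) (Suc n) - (- \<mu>) ^ k * negpow_coeff (1 + \<alpha> * real k) n) sums (?S (Suc n) - ?S n)"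
      unfolding resolvent_coeff_def
      by (intro sums_diff summable_sums resolvent_coeff_summable) (use assms in auto)
    then have "(\<lambda>k. (- \<mu>) ^ k * negpow_coeff (\<alpha> * real k) (Suc n)) sums (?S (Suc n) - ?S n)"
      by (simp add: right_diff_distrib[symmetric] negpow_coeff_Suc_diff)
    from sums_split_initial_segment[OF this, of 1]
    have "(\<lambda>k. - \<mu> * ((- \<mu>) ^ k * negpow_coeff (\<alpha> + \<alpha> * real k) (Suc n))) sums (?S (Suc n) - ?S n)"
      by (simp add: negpow_coeff_zero algebra_simps)
    moreover have "(\<lambda>k. - \<mu> * ((- \<mu>) ^ k * negpow_coeff (\<alpha> + \<alpha> * real k) (Suc n))) sums (- \<mu> * resolvent_coeff \<alpha> \<alpha> (Suc n) \<mu>)"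
      unfolding resolvent_coeff_def
      by (intro sums_mult summable_sums resolvent_coeff_summable) (use assms in auto)
    ultimately have "?S (Suc n) - ?S n = - \<mu> * resolvent_coeff \<alpha> \<alpha> (Suc n) \<mu>"
      by (rule sums_unique2)
    moreover have "0 \<le> resolvent_coeff \<alpha> \<alpha> (Suc n) \<mu>"
      by (rule resolvent_coeff_nonneg) (use assms in \<open>auto intro: negpow_coeff_nonneg\<close>)
    then have "0 \<le> \<mu> * resolvent_coeff \<alpha> \<alpha> (Suc n) \<mu>" using assms by simp
    ultimately show ?thesis by simp
  qed
  have anti: "?S n \<le> ?S m" if "m \<le> n" for m n
    using lift_Suc_antimono_le[of ?S, OF mono that] .
  have "(\<lambda>k. - \<mu> * ((- \<mu>) ^ k * negpow_coeff (\<alpha> + 1 + \<alpha> * real k) n)) sums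
      (- \<mu> * (\<Sum>j\<le>n. negpow_coeff \<alpha> j * ?S (n - j)))"
    by (intro sums_mult resolvent_coeff_convolution) (use assms in auto)
  moreover have "(\<lambda>k. - \<mu> * ((- \<mu>) ^ k * negpow_coeff (\<alpha> + 1 + \<alpha> * real k) n)) sums (?S n - 1)"
    using sums_split_initial_segment[OF summable_sums[OF resolvent_coeff_summable[OF assms(1) _ _ \<mu>, of 1 n]], of 1]
    by (simp add: resolvent_coeff_def algebra_simps)
  ultimately have eq: "1 - ?S n = \<mu> * (\<Sum>j\<le>n. negpow_coeff \<alpha> j * ?S (n - j))"
    using sums_unique2 by fastforce
  have "negpow_coeff (1 + \<alpha>) n * ?S n = (\<Sum>j\<le>n. negpow_coeff \<alpha> j * negpow_coeff 1 (n - j)) * ?S n"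
    unfolding negpow_coeff_add by (simp add: add.commute)
  also have "\<dots> \<le> (\<Sum>j\<le>n. negpow_coeff \<alpha> j * ?S (n - j))"
    unfolding sum_distrib_right using assms
    by (intro sum_mono) (auto intro!: mult_left_mono anti negpow_coeff_nonneg)
  finally have "\<mu> * (negpow_coeff (1 + \<alpha>) n * ?S n) \<le> 1 - ?S n"
    unfolding eq using assms by (intro mult_left_mono) auto
  moreover have "0 \<le> ?S n"
  proof (rule resolvent_coeff_nonneg)
    show "0 \<le> negpow_coeff (1 - \<alpha>) n" for n using assms by (intro negpow_coeff_nonneg) auto
  qed (use assms in auto)
  ultimately show ?thesis by (simp add: mult.assoc)
qed

text \<open>
  At \<open>\<mu> = x n\<^bsup>-\<alpha>\<^esup>\<close> the series converges termwise to the Mittag-Leffler series, by Euler's limit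
  formula. Tannery's theorem applies with a geometric majorant from \<open>negpow_coeff_bound\<close>.
\<close>
lemma resolvent_coeff_lim:
  assumes "0 < \<alpha>"
  shows "(\<lambda>n. resolvent_coeff \<alpha> 1 n (x * real n powr (- \<alpha>))) \<longlonglongrightarrow> mittag_leffler \<alpha> (- x)"
proof -
  \<comment> \<open>With \<open>1 - \<rho> = A / n\<close>, the \<open>k\<close>-th term is at most a constant times \<open>(|x| A\<^bsup>-\<alpha>\<^esup>)\<^sup>k\<close>,
    and \<open>|x| A\<^bsup>-\<alpha>\<^esup> < 1 / 2\<close>.\<close>
  define A where "A = (2 * \<bar>x\<bar> + 1) powr (1 / \<alpha>)"
  have A: "0 < A" by (simp add: A_def)
  have Aa: "A powr \<alpha> = 2 * \<bar>x\<bar> + 1" using assms by (simp add: A_def powr_powr)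
  let ?a = "\<lambda>k n. (- (x * real n powr (- \<alpha>))) ^ k * negpow_coeff (1 + \<alpha> * real k) n"
  let ?c = "\<lambda>n. (1 / (1 - A / real n)) ^ n"
  have "?c \<longlonglongrightarrow> exp A"
    using A by real_asymp
  then have "Bseq ?c"
    by (intro convergent_imp_Bseq) (auto simp: convergent_def)
  then obtain K where K: "\<And>n. norm (?c n) \<le> K" by (auto simp: Bseq_def)
  have lim: "(\<lambda>n. ?a k n) \<longlonglongrightarrow> (- x) ^ k / Gamma (1 + \<alpha> * real k)" for k
  proof -
    have A: "(\<lambda>n. (- x) ^ k * (negpow_coeff (1 + \<alpha> * real k) n * real n powr (- (\<alpha> * real k))))
        \<longlonglongrightarrow> (- x) ^ k * (1 / Gamma (1 + \<alpha> * real k))"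
      using assms by (intro tendsto_intros negpow_coeff_lim) auto
    have B: "\<forall>\<^sub>F n in sequentially. ?a k n = (- x) ^ k * (negpow_coeff (1 + \<alpha> * real k) n * real n powr (- (\<alpha> * real k)))"
      using eventually_gt_at_top[of 0]
    proof eventually_elim
      case (elim n)
      have "(real n powr (- \<alpha>)) ^ k = real n powr (- (\<alpha> * real k))"
        using elim by (simp add: powr_powr flip: powr_realpow)
      moreover have "(- (x * real n powr (- \<alpha>))) ^ k = (- x) ^ k * (real n powr (- \<alpha>)) ^ k"
        by (metis mult_minus_left power_mult_distrib)
      ultimately show ?case by simp
    qed
    show ?thesis unfolding tendsto_cong[OF B] using A by simp
  qed
  have bound: "norm (?a k n) \<le> K * (1 / 2) ^ k" if n: "A < real n" for k n
  proof -
    have n0: "0 < real n" using A n by linarith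
    define \<rho> where "\<rho> = 1 - A / real n"
    have \<rho>: "0 < \<rho>" "\<rho> < 1" using n n0 A by (auto simp: \<rho>_def field_simps)
    have "(1 - \<rho>) powr (- (\<alpha> * real k)) = (real n powr \<alpha> / A powr \<alpha>) ^ k"
      using n0 A by (simp add: \<rho>_def powr_divide powr_minus powr_powr power_divide flip: powr_realpow)
    then have b: "negpow_coeff (1 + \<alpha> * real k) n \<le> K * (real n powr \<alpha> / A powr \<alpha>) ^ k"
      using negpow_coeff_bound[of "\<alpha> * real k" \<rho> n] \<rho> assms K[of n] n0
      by (intro order.trans[OF negpow_coeff_bound[of "\<alpha> * real k" \<rho> n]]) (auto simp: \<rho>_def intro!: mult_right_mono)
    have b0: "0 \<le> negpow_coeff (1 + \<alpha> * real k) n" using assms by (intro negpow_coeff_nonneg) auto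
    have "norm (?a k n) = (\<bar>x\<bar> * real n powr (- \<alpha>)) ^ k * negpow_coeff (1 + \<alpha> * real k) n"
      using b0 by (simp add: abs_mult power_abs)
    also have "\<dots> \<le> (\<bar>x\<bar> * real n powr (- \<alpha>)) ^ k * (K * (real n powr \<alpha> / A powr \<alpha>) ^ k)"
      using b by (intro mult_left_mono) auto
    also have "\<dots> = K * ((\<bar>x\<bar> * real n powr (- \<alpha>)) * (real n powr \<alpha> / A powr \<alpha>)) ^ k"
      by (simp only: power_mult_distrib mult.left_commute)
    also have "(\<bar>x\<bar> * real n powr (- \<alpha>)) * (real n powr \<alpha> / A powr \<alpha>) = \<bar>x\<bar> / A powr \<alpha>"
      using n0 by (simp add: powr_minus)
    also have "K * (\<bar>x\<bar> / A powr \<alpha>) ^ k \<le> K * (1 / 2) ^ k"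
    proof (intro mult_left_mono power_mono)
      show "\<bar>x\<bar> / A powr \<alpha> \<le> 1 / 2" unfolding Aa by (simp add: field_simps)
      show "0 \<le> K" using K[of 0] by (metis norm_ge_zero order.trans)
    qed auto
    finally show ?thesis .
  qed
  have "\<forall>\<^sub>F n in sequentially. A < real n"
    by real_asymp
  then have "\<forall>\<^sub>F (k, n) in at_top \<times>\<^sub>F sequentially. norm (?a k n) \<le> K * (1 / 2) ^ k"
    unfolding eventually_prod_filter
    by (intro exI[of _ "\<lambda>_. True"] exI[of _ "\<lambda>n. A < real n"]) (use bound in auto)
  moreover have "summable (\<lambda>k. K * (1 / 2 :: real) ^ k)"
    by (intro summable_mult summable_geometric) auto
  ultimately show ?thesis
    unfolding resolvent_coeff_def mittag_leffler_def
    by (intro tannerys_theorem[THEN conjunct2, THEN conjunct2] lim) auto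
qed

lemma cm_mittag_leffler:
  assumes "0 < \<alpha>" "\<alpha> \<le> 1"
  shows "cm_on Y (\<lambda>x. mittag_leffler \<alpha> (- x))"
proof -
  have nn: "0 \<le> negpow_coeff (1 - \<alpha>) n" for n using assms by (intro negpow_coeff_nonneg) auto
  have "\<forall>n. \<exists>f. cm_on (1 / 2) f \<and> (\<forall>\<mu>. \<bar>\<mu>\<bar> < 1 \<longrightarrow> f \<mu> = resolvent_coeff \<alpha> 1 n \<mu>)"
    using resolvent_coeff_cm[OF assms nn, of "1 / 2"] by auto
  then obtain F where F: "\<And>n. cm_on (1 / 2) (F n)" "\<And>n \<mu>. \<bar>\<mu>\<bar> < 1 \<Longrightarrow> F n \<mu> = resolvent_coeff \<alpha> 1 n \<mu>"
    using choice[of "\<lambda>n f. cm_on (1 / 2) f \<and> (\<forall>\<mu>. \<bar>\<mu>\<bar> < 1 \<longrightarrow> f \<mu> = resolvent_coeff \<alpha> 1 n \<mu>)"] by blast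
  \<comment> \<open>The approximants are available on \<open>\<mu> \<ge> - 1 / 2\<close> only, which covers \<open>x \<ge> - Y\<close> after rescaling as
    soon as \<open>Y n\<^bsup>-\<alpha>\<^esup> < 1 / 2\<close>.\<close>
  have lim0: "(\<lambda>n. c * real n powr (- \<alpha>)) \<longlonglongrightarrow> 0" for c
    using assms by real_asymp
  have "\<forall>\<^sub>F n in sequentially. Y * real n powr (- \<alpha>) < 1 / 2"
    using lim0[of Y] by (rule order_tendstoD) auto
  then obtain N where N: "\<And>n. N \<le> n \<Longrightarrow> Y * real n powr (- \<alpha>) < 1 / 2"
    by (auto simp: eventually_sequentially)
  show ?thesis
  proof (rule cm_lim)
    show "cm_on Y (\<lambda>x. F (n + N) (real (n + N) powr (- \<alpha>) * x))" for n
      by (rule cm_rescale[OF F(1)]) (use N[of "n + N"] in \<open>auto simp: mult.commute\<close>)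
    fix x
    have "\<forall>\<^sub>F n in sequentially. \<bar>x * real n powr (- \<alpha>)\<bar> < 1"
      using tendsto_rabs[OF lim0[of x]] by (intro order_tendstoD(2)[where a = 1]) auto
    then have "\<forall>\<^sub>F n in sequentially. resolvent_coeff \<alpha> 1 n (x * real n powr (- \<alpha>)) = F n (real n powr (- \<alpha>) * x)"
      by eventually_elim (simp add: F(2) mult.commute)
    with resolvent_coeff_lim[OF assms(1), of x]
    have "(\<lambda>n. F n (real n powr (- \<alpha>) * x)) \<longlonglongrightarrow> mittag_leffler \<alpha> (- x)"
      by (simp add: tendsto_cong)
    then show "(\<lambda>n. F (n + N) (real (n + N) powr (- \<alpha>) * x)) \<longlonglongrightarrow> mittag_leffler \<alpha> (- x)"
      by (rule LIMSEQ_ignore_initial_segment)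
  qed
qed

text \<open>
  This is the limit of \<open>resolvent_coeff_bound\<close>. For \<open>\<beta> > 1\<close> it makes \<open>E\<^sub>\<alpha> (- |\<xi>|\<^bsup>\<beta>\<^esup>)\<close> integrable
  on the line.
\<close>
lemma mittag_leffler_decay:
  assumes "0 < \<alpha>" "\<alpha> \<le> 1" "0 < x"
  shows "mittag_leffler \<alpha> (- x) \<le> Gamma (1 + \<alpha>) / x"
proof -
  have "(\<lambda>n. x * (negpow_coeff (1 + \<alpha>) n * real n powr (- \<alpha>)) * resolvent_coeff \<alpha> 1 n (x * real n powr (- \<alpha>)))
      \<longlonglongrightarrow> x * (1 / Gamma (1 + \<alpha>)) * mittag_leffler \<alpha> (- x)"
    using assms by (intro tendsto_intros negpow_coeff_lim resolvent_coeff_lim) auto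
  moreover have "\<forall>\<^sub>F n in sequentially. x * real n powr (- \<alpha>) < 1"
    using assms by real_asymp
  then have "\<forall>\<^sub>F n in sequentially.
      x * (negpow_coeff (1 + \<alpha>) n * real n powr (- \<alpha>)) * resolvent_coeff \<alpha> 1 n (x * real n powr (- \<alpha>)) \<le> 1"
  proof eventually_elim
    case (elim n)
    then show ?case
      using resolvent_coeff_bound[OF assms(1,2), of "x * real n powr (- \<alpha>)" n] assms by (simp add: mult_ac)
  qed
  ultimately have "x * (1 / Gamma (1 + \<alpha>)) * mittag_leffler \<alpha> (- x) \<le> 1"
    by (intro tendsto_upperbound[of _ _ sequentially]) auto
  moreover have "0 < Gamma (1 + \<alpha>)" using assms by (intro Gamma_real_pos) auto
  ultimately show ?thesis using assms by (simp add: field_simps)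
qed

section \<open>Gaussian integrals\<close>

lemma gaussian_fourier_real:
  fixes y \<sigma> :: real
  assumes "0 < \<sigma>"
  shows "integrable lborel (\<lambda>x. complex_of_real (exp (- \<sigma> * x\<^sup>2)) * cis (y * x))"
    and "(LINT x|lborel. complex_of_real (exp (- \<sigma> * x\<^sup>2)) * cis (y * x))
      = complex_of_real (sqrt (pi / \<sigma>) * exp (- y\<^sup>2 / (4 * \<sigma>)))"
proof -
  let ?f = "\<lambda>x. complex_of_real (exp (- \<sigma> * x\<^sup>2)) * cis (y * x)"
  \<comment> \<open>The substitution \<open>x \<mapsto> x / ?r\<close> reduces to the characteristic function of the standard normal
    distribution.\<close>
  let ?r = "sqrt (2 * \<sigma>)"
  have r: "0 < ?r" "?r * ?r = 2 * \<sigma>" "?r\<^sup>2 = 2 * \<sigma>" using assms by simp_all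
  let ?g = "\<lambda>x. std_normal_density x *\<^sub>R iexp ((y / ?r) * x)"
  have eq: "?f (0 + (1 / ?r) * x) = complex_of_real (sqrt (2 * pi)) * ?g x" for x
  proof -
    have "\<sigma> * (x / ?r)\<^sup>2 = x\<^sup>2 / 2"
      using r(3) assms by (simp add: power_divide)
    then have "exp (- \<sigma> * ((1 / ?r) * x)\<^sup>2) = sqrt (2 * pi) * std_normal_density x"
      by (simp add: std_normal_density_def)
    moreover have "cis (y * ((1 / ?r) * x)) = iexp ((y / ?r) * x)"
      by (simp add: cis_conv_exp)
    ultimately show ?thesis
      by (simp add: scaleR_conv_of_real)
  qed
  have ig: "integrable lborel ?g"
  proof (rule Bochner_Integration.integrable_bound[of _ std_normal_density])
    show "integrable lborel std_normal_density" by (rule integrable_normal_density) simp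
    show "AE x in lborel. norm (?g x) \<le> norm (std_normal_density x)"
      by (simp add: norm_mult)
  qed measurable
  have "integrable lborel (\<lambda>x. ?f (0 + (1 / ?r) * x))"
    unfolding eq by (rule integrable_mult_right) (rule ig)
  then show "integrable lborel ?f"
    by (subst (asm) lborel_integrable_real_affine_iff) (use r in auto)
  have "(LINT x|lborel. ?g x) = char std_normal_distribution (y / ?r)"
    unfolding char_def by (subst integral_density) (auto simp: normal_density_nonneg)
  also have "\<dots> = complex_of_real (exp (- (y / ?r)\<^sup>2 / 2))"
    by (simp add: char_std_normal_distribution)
  also have "- (y / ?r)\<^sup>2 / 2 = - y\<^sup>2 / (4 * \<sigma>)"
    unfolding power_divide r(3) by simp
  finally have g: "(LINT x|lborel. ?g x) = complex_of_real (exp (- y\<^sup>2 / (4 * \<sigma>)))" by simp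
  have "(LINT x|lborel. ?f x) = \<bar>1 / ?r\<bar> *\<^sub>R (LINT x|lborel. ?f (0 + (1 / ?r) * x))"
    by (rule lborel_integral_real_affine) (use r in auto)
  also have "\<dots> = (1 / ?r) *\<^sub>R (complex_of_real (sqrt (2 * pi)) * complex_of_real (exp (- y\<^sup>2 / (4 * \<sigma>))))"
    unfolding eq integral_mult_right_zero g using r(1) by simp
  also have "\<dots> = complex_of_real (sqrt (2 * pi) / ?r * exp (- y\<^sup>2 / (4 * \<sigma>)))"
    by (simp add: scaleR_conv_of_real)
  also have "sqrt (2 * pi) / ?r = sqrt (pi / \<sigma>)"
    using assms by (simp flip: real_sqrt_divide)
  finally show "(LINT x|lborel. ?f x) = complex_of_real (sqrt (pi / \<sigma>) * exp (- y\<^sup>2 / (4 * \<sigma>)))" .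
qed

text \<open>
  Lebesgue measure on a Euclidean space is the product of the measures on the coordinate axes.
\<close>
lemma lborel_prod_Basis:
  fixes f :: "'a::euclidean_space \<Rightarrow> real \<Rightarrow> 'b::{real_normed_field,banach,second_countable_topology}"
  assumes "\<And>b. b \<in> Basis \<Longrightarrow> integrable lborel (f b)"
  shows "integrable lborel (\<lambda>x. \<Prod>b\<in>Basis. f b (x \<bullet> b))"
    and "(LINT x|lborel. (\<Prod>b\<in>Basis. f b (x \<bullet> b))) = (\<Prod>b\<in>Basis. (LINT t|lborel. f b t))"
proof -
  interpret product_sigma_finite "\<lambda>_::'a. lborel :: real measure" ..
  let ?P = "Pi\<^sub>M (Basis :: 'a set) (\<lambda>_. lborel :: real measure)"
  let ?T = "\<lambda>g. \<Sum>b\<in>Basis. g b *\<^sub>R (b :: 'a)"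
  have T: "?T \<in> ?P \<rightarrow>\<^sub>M borel" by measurable
  have m: "(\<lambda>x. \<Prod>b\<in>Basis. f b (x \<bullet> b)) \<in> borel_measurable borel"
  proof (rule borel_measurable_prod)
    fix b :: 'a assume "b \<in> Basis"
    with assms have [measurable]: "f b \<in> borel_measurable borel"
      using borel_measurable_integrable by fastforce
    show "(\<lambda>x. f b (x \<bullet> b)) \<in> borel_measurable borel" by measurable
  qed
  have eq: "(\<Prod>b\<in>Basis. f b (?T g \<bullet> b)) = (\<Prod>b\<in>Basis. f b (g b))" for g
    by (intro prod.cong refl) (simp add: inner_sum_left inner_Basis if_distrib cong: if_cong)
  have "integrable ?P (\<lambda>g. \<Prod>b\<in>Basis. f b (g b))"
    by (rule product_integrable_prod) (use assms in auto)
  then show "integrable lborel (\<lambda>x. \<Prod>b\<in>Basis. f b (x \<bullet> b))"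
    unfolding lborel_eq[where 'a='a] integrable_distr_eq[OF T m] eq .
  have "(LINT g|?P. (\<Prod>b\<in>Basis. f b (g b))) = (\<Prod>b\<in>Basis. (LINT t|lborel. f b t))"
    by (rule product_integral_prod) (use assms in auto)
  then show "(LINT x|lborel. (\<Prod>b\<in>Basis. f b (x \<bullet> b))) = (\<Prod>b\<in>Basis. (LINT t|lborel. f b t))"
    unfolding lborel_eq[where 'a='a] integral_distr[OF T m] eq .
qed

text \<open>
  The Fourier transform of \<open>\<xi> \<mapsto> e\<^bsup>-\<sigma>|\<xi>|^2\<^esup>\<close> without a normalising factor, so that the total mass
  is \<open>(2\<pi>)\<^sup>d\<close> for every \<open>\<sigma>\<close>.
\<close>
definition gauss_kernel :: "real \<Rightarrow> 'a::euclidean_space \<Rightarrow> real" where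
  "gauss_kernel \<sigma> y = sqrt (pi / \<sigma>) ^ DIM('a) * exp (- (norm y)\<^sup>2 / (4 * \<sigma>))"

lemma gauss_kernel_nonneg: "0 < \<sigma> \<Longrightarrow> 0 \<le> gauss_kernel \<sigma> y"
  by (simp add: gauss_kernel_def)

lemma gaussian_fourier_complex:
  fixes y :: "'a::euclidean_space"
  assumes "0 < \<sigma>"
  shows "integrable lborel (\<lambda>\<xi>. complex_of_real (exp (- \<sigma> * (norm \<xi>)\<^sup>2)) * cis (\<xi> \<bullet> y))"
    and "(LINT \<xi>|lborel. complex_of_real (exp (- \<sigma> * (norm \<xi>)\<^sup>2)) * cis (\<xi> \<bullet> y))
      = complex_of_real (gauss_kernel \<sigma> y)"
proof -
  let ?f = "\<lambda>b x. complex_of_real (exp (- \<sigma> * x\<^sup>2)) * cis ((y \<bullet> b) * x)"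
  have eq: "complex_of_real (exp (- \<sigma> * (norm \<xi>)\<^sup>2)) * cis (\<xi> \<bullet> y) = (\<Prod>b\<in>Basis. ?f b (\<xi> \<bullet> b))" for \<xi>
  proof -
    have "(norm \<xi>)\<^sup>2 = (\<Sum>b\<in>Basis. (\<xi> \<bullet> b)\<^sup>2)"
      by (subst power2_norm_eq_inner, subst euclidean_inner) (simp add: power2_eq_square)
    then have "exp (- \<sigma> * (norm \<xi>)\<^sup>2) = (\<Prod>b\<in>Basis. exp (- \<sigma> * (\<xi> \<bullet> b)\<^sup>2))"
      by (simp add: exp_sum[symmetric] sum_distrib_left sum_negf)
    moreover have "cis (\<xi> \<bullet> y) = (\<Prod>b\<in>Basis. cis ((y \<bullet> b) * (\<xi> \<bullet> b)))"
      unfolding euclidean_inner[of \<xi> y] cis_conv_exp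
      by (simp add: exp_sum[symmetric] sum_distrib_left mult.commute)
    ultimately show ?thesis by (simp add: prod.distrib)
  qed
  show "integrable lborel (\<lambda>\<xi>. complex_of_real (exp (- \<sigma> * (norm \<xi>)\<^sup>2)) * cis (\<xi> \<bullet> y))"
    unfolding eq by (rule lborel_prod_Basis) (rule gaussian_fourier_real[OF assms])
  have "(LINT \<xi>|lborel. complex_of_real (exp (- \<sigma> * (norm \<xi>)\<^sup>2)) * cis (\<xi> \<bullet> y))
      = (\<Prod>b\<in>Basis. (LINT t|lborel. ?f b t))"
    unfolding eq by (rule lborel_prod_Basis) (rule gaussian_fourier_real[OF assms])
  also have "\<dots> = (\<Prod>b\<in>(Basis::'a set). complex_of_real (sqrt (pi / \<sigma>) * exp (- (y \<bullet> b)\<^sup>2 / (4 * \<sigma>))))"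
    by (simp only: gaussian_fourier_real(2)[OF assms])
  also have "\<dots> = complex_of_real (\<Prod>b\<in>(Basis::'a set). sqrt (pi / \<sigma>) * exp (- (y \<bullet> b)\<^sup>2 / (4 * \<sigma>)))"
    by simp
  also have "(\<Prod>b\<in>(Basis::'a set). sqrt (pi / \<sigma>) * exp (- (y \<bullet> b)\<^sup>2 / (4 * \<sigma>))) = gauss_kernel \<sigma> y"
  proof -
    have "(norm y)\<^sup>2 = (\<Sum>b\<in>Basis. (y \<bullet> b)\<^sup>2)"
      by (subst power2_norm_eq_inner, subst euclidean_inner) (simp add: power2_eq_square)
    then have "exp (- (norm y)\<^sup>2 / (4 * \<sigma>)) = (\<Prod>b\<in>Basis. exp (- (y \<bullet> b)\<^sup>2 / (4 * \<sigma>)))"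
      by (simp add: exp_sum[symmetric] sum_divide_distrib sum_negf)
    then show ?thesis by (simp add: gauss_kernel_def prod.distrib)
  qed
  finally show "(LINT \<xi>|lborel. complex_of_real (exp (- \<sigma> * (norm \<xi>)\<^sup>2)) * cis (\<xi> \<bullet> y))
      = complex_of_real (gauss_kernel \<sigma> y)" .
qed

lemma gaussian_fourier:
  fixes y :: "'a::euclidean_space"
  assumes "0 < \<sigma>"
  shows "(LINT \<xi>|lborel. exp (- \<sigma> * (norm \<xi>)\<^sup>2) * cos (\<xi> \<bullet> y)) = gauss_kernel \<sigma> y"
  using integral_Re[OF gaussian_fourier_complex(1)[OF assms, of y]] gaussian_fourier_complex(2)[OF assms, of y]
  by (simp add: Re_divide_of_real)

lemma integrable_gaussian:
  assumes "0 < \<sigma>"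
  shows "integrable lborel (\<lambda>\<xi>::'a::euclidean_space. exp (- \<sigma> * (norm \<xi>)\<^sup>2))"
  using integrable_Re[OF gaussian_fourier_complex(1)[OF assms, of "0::'a"]] by simp

lemma gauss_kernel_integral:
  assumes "0 < \<sigma>"
  shows "integrable lborel (gauss_kernel \<sigma> :: 'a::euclidean_space \<Rightarrow> real)"
    and "(LINT y|lborel. gauss_kernel \<sigma> (y :: 'a)) = (2 * pi) ^ DIM('a)"
proof -
  have eq: "gauss_kernel \<sigma> = (\<lambda>y::'a. sqrt (pi / \<sigma>) ^ DIM('a) * exp (- (1 / (4 * \<sigma>)) * (norm y)\<^sup>2))"
    by (auto simp: gauss_kernel_def)
  have \<sigma>: "0 < 1 / (4 * \<sigma>)" using assms by simp
  show "integrable lborel (gauss_kernel \<sigma> :: 'a \<Rightarrow> real)"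
    unfolding eq by (rule integrable_mult_right) (rule integrable_gaussian[OF \<sigma>])
  have "(LINT y|lborel. gauss_kernel \<sigma> (y :: 'a)) = sqrt (pi / \<sigma>) ^ DIM('a) * gauss_kernel (1 / (4 * \<sigma>)) (0::'a)"
    unfolding eq integral_mult_right_zero using gaussian_fourier[OF \<sigma>, of "0::'a"] by simp
  also have "\<dots> = (sqrt (pi / \<sigma>) * sqrt (pi / (1 / (4 * \<sigma>)))) ^ DIM('a)"
    by (simp add: gauss_kernel_def power_mult_distrib)
  also have "sqrt (pi / \<sigma>) * sqrt (pi / (1 / (4 * \<sigma>))) = 2 * pi"
  proof -
    have eq: "pi / \<sigma> * (pi / (1 / (4 * \<sigma>))) = (2 * pi)\<^sup>2"
      using assms by (simp add: power2_eq_square)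
    show ?thesis by (simp only: real_sqrt_mult[symmetric] eq real_sqrt_abs) simp
  qed
  finally show "(LINT y|lborel. gauss_kernel \<sigma> (y :: 'a)) = (2 * pi) ^ DIM('a)" .
qed

section \<open>Mollified Fourier inversion of radial symbols\<close>

text \<open>
  Up to the factor \<open>(2\<pi>)\<^sup>d\<close>, this is the inverse Fourier transform of the radial symbol
  \<open>f (|\<xi>|\<^sup>2)\<close>, convolved with a Gaussian of variance \<open>2\<epsilon>\<close> in each coordinate. The Gaussian
  factor makes the integral converge for every bounded measurable symbol.
\<close>
definition mollified :: "(real \<Rightarrow> real) \<Rightarrow> real \<Rightarrow> 'a::euclidean_space \<Rightarrow> real" where
  "mollified f \<epsilon> a = (LINT \<xi>|lborel. f ((norm \<xi>)\<^sup>2) * (exp (- \<epsilon> * (norm \<xi>)\<^sup>2) * cos (\<xi> \<bullet> a)))"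

lemma cm_norm_measurable:
  assumes "cm_on 0 f"
  shows "(\<lambda>\<xi>::'a::euclidean_space. f ((norm \<xi>)\<^sup>2)) \<in> borel_measurable borel"
  by (rule cm_measurable[OF assms]) auto

lemma cm_norm_bound:
  assumes "cm_on 0 f"
  shows "\<bar>f ((norm \<xi>)\<^sup>2)\<bar> \<le> f 0"
  using cm_nonneg[OF assms, of "(norm \<xi>)\<^sup>2"] cm_antimono[OF assms, of 0 "(norm \<xi>)\<^sup>2"] by simp

lemma mollified_integrable:
  fixes a :: "'a::euclidean_space"
  assumes "cm_on 0 f" "0 < \<epsilon>"
  shows "integrable lborel (\<lambda>\<xi>. f ((norm \<xi>)\<^sup>2) * (exp (- \<epsilon> * (norm \<xi>)\<^sup>2) * cos (\<xi> \<bullet> a)))"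
proof (rule Bochner_Integration.integrable_bound)
  show "integrable lborel (\<lambda>\<xi>::'a. f 0 * exp (- \<epsilon> * (norm \<xi>)\<^sup>2))"
    by (rule integrable_mult_right) (rule integrable_gaussian[OF assms(2)])
  note cm_norm_measurable[OF assms(1), measurable]
  show "(\<lambda>\<xi>. f ((norm \<xi>)\<^sup>2) * (exp (- \<epsilon> * (norm \<xi>)\<^sup>2) * cos (\<xi> \<bullet> a))) \<in> borel_measurable lborel"
    by measurable
  show "AE \<xi> in lborel. norm (f ((norm \<xi>)\<^sup>2) * (exp (- \<epsilon> * (norm \<xi>)\<^sup>2) * cos (\<xi> \<bullet> a)))
      \<le> norm (f 0 * exp (- \<epsilon> * (norm \<xi>)\<^sup>2))"
  proof (rule AE_I2)
    fix \<xi> :: 'a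
    have "\<bar>f ((norm \<xi>)\<^sup>2)\<bar> * (exp (- \<epsilon> * (norm \<xi>)\<^sup>2) * \<bar>cos (\<xi> \<bullet> a)\<bar>)
        \<le> \<bar>f 0\<bar> * (exp (- \<epsilon> * (norm \<xi>)\<^sup>2) * 1)"
      using cm_norm_bound[OF assms(1), of \<xi>] by (intro mult_mono) auto
    then show "norm (f ((norm \<xi>)\<^sup>2) * (exp (- \<epsilon> * (norm \<xi>)\<^sup>2) * cos (\<xi> \<bullet> a)))
      \<le> norm (f 0 * exp (- \<epsilon> * (norm \<xi>)\<^sup>2))"
      by (simp add: abs_mult)
  qed
qed

text \<open>
  For \<open>f x = e\<^bsup>-sx\<^esup>\<close> the mollified inverse transform is \<open>gauss_kernel (s + \<epsilon>)\<close> and \<open>f (- Y) = e\<^bsup>sY\<^esup>\<close>,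
  so the hypothesis is the conclusion for the generators. Both sides are linear in \<open>f\<close>, and pointwise
  limits are dominated because functions in the cone are bounded by their value at \<open>0\<close>.
\<close>
lemma cm_transfer:
  fixes a :: "'i \<Rightarrow> 'a::euclidean_space"
  assumes "cm_on Y f" and Y: "0 \<le> Y" and \<epsilon>: "0 < \<epsilon>"
    and le: "\<And>s. 0 \<le> s \<Longrightarrow> 0 \<le> (\<Sum>i\<in>A. c i * gauss_kernel (s + \<epsilon>) (a i)) + D * exp (s * Y)"
  shows "0 \<le> (\<Sum>i\<in>A. c i * mollified f \<epsilon> (a i)) + D * f (- Y)"
  using assms(1)
proof (induction rule: cm_on.induct)
  case (cm_exp s)
  have "mollified (\<lambda>x. exp (- s * x)) \<epsilon> b = gauss_kernel (s + \<epsilon>) b" for b :: 'a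
    using gaussian_fourier[of "s + \<epsilon>" b] cm_exp \<epsilon>
    by (simp add: mollified_def exp_add[symmetric] distrib_right mult.assoc[symmetric])
       (simp add: algebra_simps)
  then show ?case using le[OF cm_exp] by simp
next
  case (cm_add f g)
  have w: "cm_on 0 f" "cm_on 0 g" using cm_add Y by (auto intro: cm_weaken)
  have "mollified (\<lambda>x. f x + g x) \<epsilon> b = mollified f \<epsilon> b + mollified g \<epsilon> b" for b :: 'a
    unfolding mollified_def distrib_right
    by (rule Bochner_Integration.integral_add) (rule mollified_integrable w \<epsilon>)+
  then show ?case using cm_add.IH by (simp add: sum.distrib algebra_simps)
next
  case (cm_scale k f)
  have "mollified (\<lambda>x. k * f x) \<epsilon> b = k * mollified f \<epsilon> b" for b :: 'a
    by (simp add: mollified_def mult.assoc)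
  then have "(\<Sum>i\<in>A. c i * mollified (\<lambda>x. k * f x) \<epsilon> (a i)) + D * (k * f (- Y))
      = k * ((\<Sum>i\<in>A. c i * mollified f \<epsilon> (a i)) + D * f (- Y))"
    by (simp add: distrib_left sum_distrib_left mult.left_commute)
  also have "0 \<le> \<dots>" using cm_scale by (intro mult_nonneg_nonneg) auto
  finally show ?case .
next
  case (cm_lim f g)
  have w: "cm_on 0 (f n)" for n using cm_lim.hyps(1) Y by (auto intro: cm_weaken)
  have g: "cm_on 0 g"
  proof (rule cm_on.cm_lim[of 0 f])
    show "(\<lambda>n. f n x) \<longlonglongrightarrow> g x" if "- 0 \<le> x" for x
      by (rule cm_lim.hyps(2)) (use that Y in linarith)
  qed (rule w)
  have "Bseq (\<lambda>n. f n 0)"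
    using cm_lim.hyps(2)[of 0] Y by (intro convergent_imp_Bseq) (auto simp: convergent_def)
  then obtain B where B: "\<And>n. norm (f n 0) \<le> B" by (auto simp: Bseq_def)
  have lim: "(\<lambda>n. mollified (f n) \<epsilon> b) \<longlonglongrightarrow> mollified g \<epsilon> b" for b :: 'a
    unfolding mollified_def
  proof (rule integral_dominated_convergence)
    show "integrable lborel (\<lambda>\<xi>::'a. B * exp (- \<epsilon> * (norm \<xi>)\<^sup>2))"
      by (rule integrable_mult_right) (rule integrable_gaussian[OF \<epsilon>])
    show "(\<lambda>\<xi>. g ((norm \<xi>)\<^sup>2) * (exp (- \<epsilon> * (norm \<xi>)\<^sup>2) * cos (\<xi> \<bullet> b))) \<in> borel_measurable lborel"
      by (rule borel_measurable_integrable[OF mollified_integrable[OF g \<epsilon>]])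
    show "(\<lambda>\<xi>. f n ((norm \<xi>)\<^sup>2) * (exp (- \<epsilon> * (norm \<xi>)\<^sup>2) * cos (\<xi> \<bullet> b))) \<in> borel_measurable lborel" for n
      by (rule borel_measurable_integrable[OF mollified_integrable[OF w \<epsilon>]])
    show "AE \<xi> in lborel. (\<lambda>n. f n ((norm \<xi>)\<^sup>2) * (exp (- \<epsilon> * (norm \<xi>)\<^sup>2) * cos (\<xi> \<bullet> b)))
        \<longlonglongrightarrow> g ((norm \<xi>)\<^sup>2) * (exp (- \<epsilon> * (norm \<xi>)\<^sup>2) * cos (\<xi> \<bullet> b))"
    proof (rule AE_I2, rule tendsto_mult_right, rule cm_lim.hyps(2))
      show "- Y \<le> (norm \<xi>)\<^sup>2" for \<xi> :: 'a using Y by (simp add: order_trans[of _ 0])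
    qed
    show "AE \<xi> in lborel. norm (f n ((norm \<xi>)\<^sup>2) * (exp (- \<epsilon> * (norm \<xi>)\<^sup>2) * cos (\<xi> \<bullet> b)))
        \<le> B * exp (- \<epsilon> * (norm \<xi>)\<^sup>2)" for n
    proof (rule AE_I2)
      fix \<xi> :: 'a
      have "\<bar>f n ((norm \<xi>)\<^sup>2)\<bar> * (exp (- \<epsilon> * (norm \<xi>)\<^sup>2) * \<bar>cos (\<xi> \<bullet> b)\<bar>)
          \<le> B * (exp (- \<epsilon> * (norm \<xi>)\<^sup>2) * 1)"
        using cm_norm_bound[OF w, of n \<xi>] B[of n] by (intro mult_mono) auto
      then show "norm (f n ((norm \<xi>)\<^sup>2) * (exp (- \<epsilon> * (norm \<xi>)\<^sup>2) * cos (\<xi> \<bullet> b)))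
          \<le> B * exp (- \<epsilon> * (norm \<xi>)\<^sup>2)"
        by (simp add: abs_mult)
    qed
  qed
  have "(\<lambda>n. (\<Sum>i\<in>A. c i * mollified (f n) \<epsilon> (a i)) + D * f n (- Y))
      \<longlonglongrightarrow> (\<Sum>i\<in>A. c i * mollified g \<epsilon> (a i)) + D * g (- Y)"
    by (intro tendsto_add tendsto_sum tendsto_mult_left lim cm_lim.hyps(2)) simp
  then show ?case
    by (rule LIMSEQ_le_const) (use cm_lim.IH in auto)
qed

lemma mollified_antimono:
  fixes a b :: "'a::euclidean_space"
  assumes "cm_on 0 f" "0 < \<epsilon>" "norm a \<le> norm b"
  shows "mollified f \<epsilon> b \<le> mollified f \<epsilon> a"
proof -
  have "0 \<le> (\<Sum>i\<in>{True, False}. (if i then 1 else - 1) * mollified f \<epsilon> (if i then a else b)) + 0 * f (- 0)"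
  proof (rule cm_transfer)
    fix s :: real assume s: "0 \<le> s"
    have "gauss_kernel (s + \<epsilon>) b \<le> gauss_kernel (s + \<epsilon>) a"
      unfolding gauss_kernel_def using s assms
      by (intro mult_left_mono) (auto intro!: divide_right_mono power_mono)
    then show "0 \<le> (\<Sum>i\<in>{True, False}. (if i then 1 else - 1) * gauss_kernel (s + \<epsilon>) (if i then a else b)) + 0 * exp (s * 0)"
      by simp
  qed (use assms in auto)
  then show ?thesis by simp
qed

text \<open>
  Among Gaussians with a common variance, \<open>e\<^bsup>-|b|^2\<tau>\<^esup>\<close> is at most \<open>x e\<^bsup>-|a|^2\<tau>\<^esup>\<close> when \<open>\<tau>\<close> is large, and at
  most a constant times \<open>e\<^bsup>-|c|^2\<tau>\<^esup>\<close> when \<open>\<tau>\<close> is bounded. The point is that \<open>x\<close> may be arbitrarily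
  small and that \<open>N\<close> does not depend on \<open>\<epsilon>\<close>.
\<close>
lemma mollified_interpolation:
  fixes a b c :: "'a::euclidean_space"
  assumes "cm_on 0 f" "norm a < norm b" "norm b \<le> norm c" "0 < x"
  shows "\<exists>N. \<forall>\<epsilon>>0. mollified f \<epsilon> b \<le> x * mollified f \<epsilon> a + N * mollified f \<epsilon> c"
proof -
  define p where "p = (norm b)\<^sup>2 - (norm a)\<^sup>2"
  define q where "q = (norm c)\<^sup>2 - (norm b)\<^sup>2"
  have p: "0 < p" using assms(2) by (auto simp: p_def intro: power_strict_mono)
  have q: "0 \<le> q" using assms(3) by (auto simp: q_def intro: power_mono)
  \<comment> \<open>\<open>T\<close> solves \<open>e\<^bsup>-pT\<^esup> = x\<close>.\<close>
  define T where "T = - ln x / p"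
  define N where "N = exp (q * T)"
  have "mollified f \<epsilon> b \<le> x * mollified f \<epsilon> a + N * mollified f \<epsilon> c" if \<epsilon>: "0 < \<epsilon>" for \<epsilon>
  proof -
    have "0 \<le> (\<Sum>i\<in>{0,1,2::nat}. (if i = 0 then x else if i = 1 then - 1 else N) *
        mollified f \<epsilon> (if i = 0 then a else if i = 1 then b else c)) + 0 * f (- 0)"
    proof (rule cm_transfer)
      fix s :: real assume s: "0 \<le> s"
      define \<tau> where "\<tau> = 1 / (4 * (s + \<epsilon>))"
      have \<tau>: "0 < \<tau>" using s \<epsilon> by (simp add: \<tau>_def)
      define C where "C = sqrt (pi / (s + \<epsilon>)) ^ DIM('a)"
      have C: "0 \<le> C" using s \<epsilon> by (simp add: C_def)
      have K: "gauss_kernel (s + \<epsilon>) y = C * exp (- (norm y)\<^sup>2 * \<tau>)" for y :: 'a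
        by (simp add: gauss_kernel_def C_def \<tau>_def)
      have "exp (- (norm b)\<^sup>2 * \<tau>) \<le> x * exp (- (norm a)\<^sup>2 * \<tau>) + N * exp (- (norm c)\<^sup>2 * \<tau>)"
      proof (cases "T \<le> \<tau>")
        case True
        have "exp (- (norm b)\<^sup>2 * \<tau>) = exp (- p * \<tau>) * exp (- (norm a)\<^sup>2 * \<tau>)"
          by (simp add: p_def exp_add[symmetric] algebra_simps)
        also have "\<dots> \<le> x * exp (- (norm a)\<^sup>2 * \<tau>)"
        proof (rule mult_right_mono)
          have "- p * \<tau> \<le> ln x" using True p by (simp add: T_def field_simps)
          then have "exp (- p * \<tau>) \<le> exp (ln x)" by (simp only: exp_le_cancel_iff)
          then show "exp (- p * \<tau>) \<le> x" using assms(4) by simp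
        qed simp
        finally show ?thesis by (simp add: N_def add_increasing2)
      next
        case False
        have "exp (- (norm b)\<^sup>2 * \<tau>) = exp (q * \<tau>) * exp (- (norm c)\<^sup>2 * \<tau>)"
          by (simp add: q_def exp_add[symmetric] algebra_simps)
        also have "\<dots> \<le> N * exp (- (norm c)\<^sup>2 * \<tau>)"
          unfolding N_def using False q by (intro mult_right_mono) (auto intro: mult_left_mono)
        finally show ?thesis using assms(4) by (simp add: add_increasing)
      qed
      from mult_left_mono[OF this C]
      show "0 \<le> (\<Sum>i\<in>{0,1,2::nat}. (if i = 0 then x else if i = 1 then - 1 else N) *
        gauss_kernel (s + \<epsilon>) (if i = 0 then a else if i = 1 then b else c)) + 0 * exp (s * 0)"
        by (simp add: K) (simp add: algebra_simps)
    qed (use assms \<epsilon> in auto)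
    then show ?thesis by simp
  qed
  then show ?thesis by blast
qed

text \<open>
  Completing the square gives \<open>|a|\<^sup>2 / (4\<sigma>) + y\<^sup>2 \<sigma> \<ge> y |a|\<close>. The factor \<open>e\<^bsup>y^2 s\<^esup>\<close> that is lost for
  the generator of index \<open>s\<close> is its value at \<open>- y\<^sup>2\<close>.
\<close>
lemma mollified_decay:
  fixes a :: "'a::euclidean_space"
  assumes "cm_on (y\<^sup>2) f" "0 < \<epsilon>" "0 \<le> y"
  shows "mollified f \<epsilon> a \<le> sqrt (pi / \<epsilon>) ^ DIM('a) * exp (y\<^sup>2 * \<epsilon> - y * norm a) * f (- (y\<^sup>2))"
proof -
  let ?D = "sqrt (pi / \<epsilon>) ^ DIM('a) * exp (y\<^sup>2 * \<epsilon> - y * norm a)"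
  have "0 \<le> (\<Sum>i\<in>{()}. (- 1) * mollified f \<epsilon> a) + ?D * f (- (y\<^sup>2))"
  proof (rule cm_transfer[OF assms(1)])
    fix s :: real assume s: "0 \<le> s"
    have "0 \<le> (norm a / (2 * sqrt (s + \<epsilon>)) - y * sqrt (s + \<epsilon>))\<^sup>2" by simp
    also have "\<dots> = (norm a)\<^sup>2 / (4 * (s + \<epsilon>)) + y\<^sup>2 * (s + \<epsilon>) - y * norm a"
      using s assms(2) by (simp add: power2_diff power_divide power_mult_distrib)
    finally have "- (norm a)\<^sup>2 / (4 * (s + \<epsilon>)) \<le> (y\<^sup>2 * \<epsilon> - y * norm a) + s * y\<^sup>2"
      by (simp add: algebra_simps)
    then have "exp (- (norm a)\<^sup>2 / (4 * (s + \<epsilon>))) \<le> exp (y\<^sup>2 * \<epsilon> - y * norm a) * exp (s * y\<^sup>2)"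
      by (simp only: exp_add[symmetric] exp_le_cancel_iff)
    moreover have "sqrt (pi / (s + \<epsilon>)) ^ DIM('a) \<le> sqrt (pi / \<epsilon>) ^ DIM('a)"
      using s assms(2) by (intro power_mono real_sqrt_le_mono divide_left_mono) auto
    ultimately have "gauss_kernel (s + \<epsilon>) a \<le> sqrt (pi / \<epsilon>) ^ DIM('a) * (exp (y\<^sup>2 * \<epsilon> - y * norm a) * exp (s * y\<^sup>2))"
      unfolding gauss_kernel_def using assms(2) by (intro mult_mono) auto
    then show "0 \<le> (\<Sum>i\<in>{()}. (- 1) * gauss_kernel (s + \<epsilon>) a) + ?D * exp (s * y\<^sup>2)"
      by (simp add: mult.assoc)
  qed (use assms in auto)
  then show ?thesis by simp
qed

section \<open>Densities with a completely monotone symbol\<close>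

lemma lborel_translation:
  fixes f :: "'a::euclidean_space \<Rightarrow> real"
  assumes "integrable lborel f"
  shows "integrable lborel (\<lambda>x. f (x - a))" and "(LINT x|lborel. f (x - a)) = (LINT x|lborel. f x)"
proof -
  have T: "(+) (- a) \<in> lborel \<rightarrow>\<^sub>M borel" by simp
  have m: "f \<in> borel_measurable borel" using borel_measurable_integrable[OF assms] by simp
  have D: "distr lborel borel ((+) (- a)) = lborel" by (rule lborel_distr_plus)
  show "integrable lborel (\<lambda>x. f (x - a))"
    using assms integrable_distr_eq[OF T m] by (simp add: D)
  show "(LINT x|lborel. f (x - a)) = (LINT x|lborel. f x)"
    using integral_distr[OF T m] by (simp add: D)
qed

text \<open>
  Since \<open>\<Phi>\<close> may be unbounded away from \<open>a\<close>, the far region is estimated by the supremum of the kernel times the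
  mass of \<open>\<Phi>\<close>; the constant \<open>\<Phi> a\<close> is compared there with a Gaussian of twice the variance.
\<close>
lemma gauss_approximate_identity:
  fixes \<Phi> :: "'a::euclidean_space \<Rightarrow> real"
  assumes nn: "\<And>x. 0 \<le> \<Phi> x" and int: "integrable lborel \<Phi>" and cont: "isCont \<Phi> a"
  shows "((\<lambda>\<epsilon>. LINT x|lborel. \<Phi> x * gauss_kernel \<epsilon> (x - a)) \<longlongrightarrow> (2 * pi) ^ DIM('a) * \<Phi> a) (at_right 0)"
proof (rule tendstoI)
  fix e :: real assume e: "0 < e"
  define \<eta> where "\<eta> = e / (2 * (2 * pi) ^ DIM('a))"
  have \<eta>: "0 < \<eta>" using e by (simp add: \<eta>_def)
  obtain \<delta> where \<delta>: "0 < \<delta>" "\<And>x. dist x a < \<delta> \<Longrightarrow> \<bar>\<Phi> x - \<Phi> a\<bar> < \<eta>"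
    using cont \<eta> unfolding continuous_at_eps_delta dist_real_def by blast
  define g1 where "g1 \<epsilon> = sqrt (pi / \<epsilon>) ^ DIM('a) * exp (- \<delta>\<^sup>2 / (4 * \<epsilon>))" for \<epsilon>
  define g2 where "g2 \<epsilon> = sqrt 2 ^ DIM('a) * exp (- \<delta>\<^sup>2 / (8 * \<epsilon>))" for \<epsilon>
  define R where "R \<epsilon> = g1 \<epsilon> * (LINT x|lborel. \<Phi> x) + \<Phi> a * g2 \<epsilon> * (2 * pi) ^ DIM('a)" for \<epsilon>
  have g1: "(g1 \<longlongrightarrow> 0) (at_right 0)"
  proof -
    define c where "c = \<delta>\<^sup>2 / (4 * real DIM('a))"
    have c: "0 < c" using \<delta>(1) by (simp add: c_def)
    have "((\<lambda>\<epsilon>. sqrt (pi / \<epsilon>) * exp (- c / \<epsilon>)) \<longlongrightarrow> 0) (at_right 0)"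
      using c by real_asymp
    then have lim: "((\<lambda>\<epsilon>. (sqrt (pi / \<epsilon>) * exp (- c / \<epsilon>)) ^ DIM('a)) \<longlongrightarrow> 0 ^ DIM('a)) (at_right 0)"
      by (rule tendsto_power)
    have eq: "(sqrt (pi / \<epsilon>) * exp (- c / \<epsilon>)) ^ DIM('a) = g1 \<epsilon>" for \<epsilon>
      by (simp add: g1_def c_def power_mult_distrib exp_of_nat_mult[symmetric])
    show ?thesis using lim unfolding eq by (simp add: zero_power)
  qed
  have g2: "(g2 \<longlongrightarrow> 0) (at_right 0)"
  proof -
    define c where "c = \<delta>\<^sup>2 / 8"
    have c: "0 < c" using \<delta>(1) by (simp add: c_def)
    have "((\<lambda>\<epsilon>. exp (- c / \<epsilon>)) \<longlongrightarrow> 0) (at_right 0)"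
      using c by real_asymp
    then have "((\<lambda>\<epsilon>. sqrt 2 ^ DIM('a) * exp (- c / \<epsilon>)) \<longlongrightarrow> 0) (at_right 0)"
      by (rule tendsto_mult_right_zero)
    then show ?thesis by (simp add: g2_def[abs_def] c_def)
  qed
  have "(R \<longlongrightarrow> 0 * (LINT x|lborel. \<Phi> x) + \<Phi> a * 0 * (2 * pi) ^ DIM('a)) (at_right 0)"
    unfolding R_def by (intro tendsto_intros g1 g2)
  then have "\<forall>\<^sub>F \<epsilon> in at_right 0. R \<epsilon> < e / 2"
    using e by (intro order_tendstoD(2)) auto
  moreover have "\<forall>\<^sub>F \<epsilon> in at_right 0. (0::real) < \<epsilon>" by (rule eventually_at_right_less)
  ultimately show "\<forall>\<^sub>F \<epsilon> in at_right 0.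
      dist (LINT x|lborel. \<Phi> x * gauss_kernel \<epsilon> (x - a)) ((2 * pi) ^ DIM('a) * \<Phi> a) < e"
  proof eventually_elim
    case (elim \<epsilon>)
    let ?K = "\<lambda>x. gauss_kernel \<epsilon> (x - a)"
    let ?K2 = "\<lambda>x. gauss_kernel (2 * \<epsilon>) (x - a)"
    note K = lborel_translation[OF gauss_kernel_integral(1)[OF \<open>0 < \<epsilon>\<close>], of a]
    have "0 < 2 * \<epsilon>" using elim by simp
    note K2 = lborel_translation[OF gauss_kernel_integral(1)[OF this], of a]
    have far: "gauss_kernel \<epsilon> y \<le> g1 \<epsilon>" "gauss_kernel \<epsilon> y \<le> g2 \<epsilon> * gauss_kernel (2 * \<epsilon>) y"
      if y: "\<delta> \<le> norm y" for y :: 'a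
    proof -
      have sq: "\<delta>\<^sup>2 \<le> (norm y)\<^sup>2" using y \<delta>(1) by (intro power_mono) auto
      show "gauss_kernel \<epsilon> y \<le> g1 \<epsilon>"
        unfolding gauss_kernel_def g1_def using sq elim by (intro mult_left_mono) (auto intro: divide_right_mono)
      have "gauss_kernel \<epsilon> y = sqrt (pi / \<epsilon>) ^ DIM('a) * (exp (- (norm y)\<^sup>2 / (8 * \<epsilon>)) * exp (- (norm y)\<^sup>2 / (8 * \<epsilon>)))"
        unfolding gauss_kernel_def exp_add[symmetric] using elim by simp
      also have "\<dots> \<le> sqrt (pi / \<epsilon>) ^ DIM('a) * (exp (- \<delta>\<^sup>2 / (8 * \<epsilon>)) * exp (- (norm y)\<^sup>2 / (8 * \<epsilon>)))"
        using sq elim by (intro mult_left_mono mult_right_mono) (auto intro: divide_right_mono)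
      also have "sqrt (pi / \<epsilon>) = sqrt 2 * sqrt (pi / (2 * \<epsilon>))"
        using elim by (simp add: real_sqrt_mult[symmetric])
      finally show "gauss_kernel \<epsilon> y \<le> g2 \<epsilon> * gauss_kernel (2 * \<epsilon>) y"
        by (simp add: gauss_kernel_def g2_def power_mult_distrib mult_ac)
    qed
    have pointwise: "\<bar>(\<Phi> x - \<Phi> a) * ?K x\<bar> \<le> \<eta> * ?K x + (g1 \<epsilon> * \<Phi> x + \<Phi> a * g2 \<epsilon> * ?K2 x)" for x
    proof (cases "dist x a < \<delta>")
      case True
      have "\<bar>(\<Phi> x - \<Phi> a) * ?K x\<bar> = \<bar>\<Phi> x - \<Phi> a\<bar> * ?K x"
        using gauss_kernel_nonneg[OF elim(2), of "x - a"] by (simp add: abs_mult)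
      also have "\<dots> \<le> \<eta> * ?K x"
        using \<delta>(2)[OF True] gauss_kernel_nonneg[OF elim(2), of "x - a"] by (intro mult_right_mono) auto
      also have "\<dots> \<le> \<eta> * ?K x + (g1 \<epsilon> * \<Phi> x + \<Phi> a * g2 \<epsilon> * ?K2 x)"
        using nn elim(2) gauss_kernel_nonneg[OF \<open>0 < 2 * \<epsilon>\<close>, of "x - a"] by (simp add: g1_def g2_def)
      finally show ?thesis .
    next
      case False
      then have y: "\<delta> \<le> norm (x - a)" by (simp add: dist_norm)
      have "\<bar>(\<Phi> x - \<Phi> a) * ?K x\<bar> = \<bar>\<Phi> x - \<Phi> a\<bar> * ?K x"
        using gauss_kernel_nonneg[OF elim(2), of "x - a"] by (simp add: abs_mult)
      also have "\<dots> \<le> (\<Phi> x + \<Phi> a) * ?K x"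
        using nn[of x] nn[of a] gauss_kernel_nonneg[OF elim(2), of "x - a"] by (intro mult_right_mono) auto
      also have "\<dots> \<le> \<Phi> x * g1 \<epsilon> + \<Phi> a * (g2 \<epsilon> * ?K2 x)"
        unfolding distrib_right using far[OF y] nn by (intro add_mono mult_left_mono) auto
      also have "\<dots> \<le> \<eta> * ?K x + (g1 \<epsilon> * \<Phi> x + \<Phi> a * g2 \<epsilon> * ?K2 x)"
        using \<eta> gauss_kernel_nonneg[OF elim(2), of "x - a"] by (simp add: mult_ac)
      finally show ?thesis .
    qed
    have RHS: "integrable lborel (\<lambda>x. \<eta> * ?K x + (g1 \<epsilon> * \<Phi> x + \<Phi> a * g2 \<epsilon> * ?K2 x))"
      by (intro Bochner_Integration.integrable_add integrable_mult_right K K2 int)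
    have LHS: "integrable lborel (\<lambda>x. (\<Phi> x - \<Phi> a) * ?K x)"
    proof (rule Bochner_Integration.integrable_bound[OF RHS])
      have [measurable]: "\<Phi> \<in> borel_measurable borel" using borel_measurable_integrable[OF int] by simp
      have [measurable]: "?K \<in> borel_measurable borel" using borel_measurable_integrable[OF K(1)] by simp
      show "(\<lambda>x. (\<Phi> x - \<Phi> a) * ?K x) \<in> borel_measurable lborel" by measurable
      show "AE x in lborel. norm ((\<Phi> x - \<Phi> a) * ?K x) \<le> norm (\<eta> * ?K x + (g1 \<epsilon> * \<Phi> x + \<Phi> a * g2 \<epsilon> * ?K2 x))"
        using pointwise by (intro AE_I2) (metis abs_ge_self order_trans real_norm_def)
    qed
    have "integrable lborel (\<lambda>x. (\<Phi> x - \<Phi> a) * ?K x + \<Phi> a * ?K x)"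
      by (intro Bochner_Integration.integrable_add integrable_mult_right LHS K)
    have "(LINT x|lborel. \<Phi> x * ?K x) = (LINT x|lborel. (\<Phi> x - \<Phi> a) * ?K x + \<Phi> a * ?K x)"
      by (simp add: algebra_simps)
    also have "\<dots> = (LINT x|lborel. (\<Phi> x - \<Phi> a) * ?K x) + \<Phi> a * (2 * pi) ^ DIM('a)"
      by (subst Bochner_Integration.integral_add)
        (auto intro!: LHS K simp: K gauss_kernel_integral(2)[OF elim(2)])
    finally have "dist (LINT x|lborel. \<Phi> x * ?K x) ((2 * pi) ^ DIM('a) * \<Phi> a) = \<bar>LINT x|lborel. (\<Phi> x - \<Phi> a) * ?K x\<bar>"
      by (simp add: dist_real_def)
    also have "\<dots> \<le> (LINT x|lborel. \<bar>(\<Phi> x - \<Phi> a) * ?K x\<bar>)"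
      by (rule integral_abs_bound)
    also have "\<dots> \<le> (LINT x|lborel. \<eta> * ?K x + (g1 \<epsilon> * \<Phi> x + \<Phi> a * g2 \<epsilon> * ?K2 x))"
      by (rule integral_mono[OF integrable_abs[OF LHS] RHS pointwise])
    also have "\<dots> = \<eta> * (LINT x|lborel. ?K x) + (g1 \<epsilon> * (LINT x|lborel. \<Phi> x) + \<Phi> a * g2 \<epsilon> * (LINT x|lborel. ?K2 x))"
      by (subst Bochner_Integration.integral_add, intro integrable_mult_right K,
          intro Bochner_Integration.integrable_add integrable_mult_right K2 int,
          subst Bochner_Integration.integral_add, intro integrable_mult_right int,
          intro integrable_mult_right K2) simp
    also have "\<dots> = e / 2 + R \<epsilon>"
      unfolding K(2) K2(2) gauss_kernel_integral(2)[OF elim(2)] gauss_kernel_integral(2)[OF \<open>0 < 2 * \<epsilon>\<close>]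
      by (simp add: \<eta>_def R_def)
    also have "\<dots> < e" using elim by simp
    finally show ?case .
  qed
qed

text \<open>
  A density whose Fourier transform is \<open>h (|\<xi>|\<^sup>2)\<close>, written with real integrals. The value at the origin
  is left free, as for the fundamental solution. The function \<open>h\<close> is
  determined on \<open>[0, \<infinity>)\<close> only, which allows the choice of an extension in \<open>cm_on Y\<close>.
\<close>
definition has_symbol :: "('a::euclidean_space \<Rightarrow> real) \<Rightarrow> (real \<Rightarrow> real) \<Rightarrow> bool" where
  "has_symbol \<Phi> h \<longleftrightarrow>
    (\<forall>x. 0 \<le> \<Phi> x) \<and> integrable lborel \<Phi> \<and> continuous_on (- {0}) \<Phi> \<and>
    (\<forall>\<xi>. (LINT x|lborel. \<Phi> x * cos (\<xi> \<bullet> x)) = h ((norm \<xi>)\<^sup>2)) \<and>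
    (\<forall>\<xi>. (LINT x|lborel. \<Phi> x * sin (\<xi> \<bullet> x)) = 0)"

lemma has_symbolD:
  assumes "has_symbol \<Phi> h"
  shows "0 \<le> \<Phi> x" "integrable lborel \<Phi>" "continuous_on (- {0}) \<Phi>"
    "(LINT x|lborel. \<Phi> x * cos (\<xi> \<bullet> x)) = h ((norm \<xi>)\<^sup>2)"
    "(LINT x|lborel. \<Phi> x * sin (\<xi> \<bullet> x)) = 0"
  using assms by (auto simp: has_symbol_def)

text \<open>
  By Fubini's theorem, after writing the Gaussian as the Fourier transform of a Gaussian.
\<close>
lemma symbol_mollified:
  fixes \<Phi> :: "'a::euclidean_space \<Rightarrow> real"
  assumes \<Phi>: "has_symbol \<Phi> h" and \<epsilon>: "0 < \<epsilon>"
  shows "(LINT x|lborel. \<Phi> x * gauss_kernel \<epsilon> (x - a)) = mollified h \<epsilon> a"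
proof -
  let ?w = "\<lambda>\<xi>::'a. exp (- \<epsilon> * (norm \<xi>)\<^sup>2)"
  have [measurable]: "\<Phi> \<in> borel_measurable borel"
    using borel_measurable_integrable[OF has_symbolD(2)[OF \<Phi>]] by simp
  have dom: "integrable (lborel \<Otimes>\<^sub>M lborel) (\<lambda>(x, \<xi>). \<Phi> x * ?w \<xi>)"
  proof (rule lborel_pair.Fubini_integrable)
    show "(\<lambda>(x, \<xi>). \<Phi> x * ?w \<xi>) \<in> borel_measurable (lborel \<Otimes>\<^sub>M lborel)" by measurable
    show "AE x in lborel. integrable lborel (\<lambda>\<xi>. case (x, \<xi>) of (x, \<xi>) \<Rightarrow> \<Phi> x * ?w \<xi>)"
      by (intro AE_I2) (simp add: integrable_gaussian[OF \<epsilon>, simplified])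
    have "integrable lborel (\<lambda>x. \<Phi> x * (LINT \<xi>|lborel. ?w \<xi>))"
      by (rule integrable_mult_left) (rule has_symbolD(2)[OF \<Phi>])
    then show "integrable lborel (\<lambda>x. LINT \<xi>|lborel. norm (case (x, \<xi>) of (x, \<xi>) \<Rightarrow> \<Phi> x * ?w \<xi>))"
      using has_symbolD(1)[OF \<Phi>] by (simp add: abs_mult)
  qed
  have int: "integrable (lborel \<Otimes>\<^sub>M lborel) (\<lambda>(x, \<xi>). \<Phi> x * (?w \<xi> * cos (\<xi> \<bullet> (x - a))))"
  proof (rule Bochner_Integration.integrable_bound[OF dom])
    show "(\<lambda>(x, \<xi>). \<Phi> x * (?w \<xi> * cos (\<xi> \<bullet> (x - a)))) \<in> borel_measurable (lborel \<Otimes>\<^sub>M lborel)" by measurable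
    have "\<bar>\<Phi> x\<bar> * (?w \<xi> * \<bar>cos (\<xi> \<bullet> (x - a))\<bar>) \<le> \<bar>\<Phi> x\<bar> * (?w \<xi> * 1)" for x \<xi>
      by (intro mult_left_mono) auto
    then show "AE p in lborel \<Otimes>\<^sub>M lborel. norm (case p of (x, \<xi>) \<Rightarrow> \<Phi> x * (?w \<xi> * cos (\<xi> \<bullet> (x - a))))
        \<le> norm (case p of (x, \<xi>) \<Rightarrow> \<Phi> x * ?w \<xi>)"
      by (intro AE_I2) (auto simp: abs_mult split: prod.split)
  qed
  have inner: "(LINT x|lborel. \<Phi> x * (?w \<xi> * cos (\<xi> \<bullet> (x - a)))) = h ((norm \<xi>)\<^sup>2) * (?w \<xi> * cos (\<xi> \<bullet> a))" for \<xi>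
  proof -
    have c: "integrable lborel (\<lambda>x. \<Phi> x * cos (\<xi> \<bullet> x))" "integrable lborel (\<lambda>x. \<Phi> x * sin (\<xi> \<bullet> x))"
      by (rule Bochner_Integration.integrable_bound[OF has_symbolD(2)[OF \<Phi>]];
          auto simp: abs_mult intro!: mult_left_le)+
    have "\<Phi> x * (?w \<xi> * cos (\<xi> \<bullet> (x - a)))
        = (?w \<xi> * cos (\<xi> \<bullet> a)) * (\<Phi> x * cos (\<xi> \<bullet> x)) + (?w \<xi> * sin (\<xi> \<bullet> a)) * (\<Phi> x * sin (\<xi> \<bullet> x))" for x
      by (simp add: inner_diff_right cos_diff algebra_simps)
    then have "(LINT x|lborel. \<Phi> x * (?w \<xi> * cos (\<xi> \<bullet> (x - a))))
        = (?w \<xi> * cos (\<xi> \<bullet> a)) * (LINT x|lborel. \<Phi> x * cos (\<xi> \<bullet> x))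
        + (?w \<xi> * sin (\<xi> \<bullet> a)) * (LINT x|lborel. \<Phi> x * sin (\<xi> \<bullet> x))"
      using c by (simp only: Bochner_Integration.integral_add integrable_mult_right integral_mult_right_zero)
    then show ?thesis by (simp add: has_symbolD(4,5)[OF \<Phi>])
  qed
  have "mollified h \<epsilon> a = (LINT \<xi>|lborel. LINT x|lborel. \<Phi> x * (?w \<xi> * cos (\<xi> \<bullet> (x - a))))"
    unfolding mollified_def inner ..
  also have "\<dots> = (LINT x|lborel. LINT \<xi>|lborel. \<Phi> x * (?w \<xi> * cos (\<xi> \<bullet> (x - a))))"
    by (rule lborel_pair.Fubini_integral[OF int])
  also have "\<dots> = (LINT x|lborel. \<Phi> x * gauss_kernel \<epsilon> (x - a))"
    by (simp only: integral_mult_right_zero gaussian_fourier[OF \<epsilon>])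
  finally show ?thesis ..
qed

lemma symbol_inversion:
  fixes a :: "'a::euclidean_space"
  assumes \<Phi>: "has_symbol \<Phi> h" and a: "a \<noteq> 0"
  shows "((\<lambda>\<epsilon>. mollified h \<epsilon> a) \<longlongrightarrow> (2 * pi) ^ DIM('a) * \<Phi> a) (at_right 0)"
proof -
  have "isCont \<Phi> a"
    using has_symbolD(3)[OF \<Phi>] a by (simp add: continuous_on_eq_continuous_at open_Compl)
  with has_symbolD(1,2)[OF \<Phi>]
  have "((\<lambda>\<epsilon>. LINT x|lborel. \<Phi> x * gauss_kernel \<epsilon> (x - a)) \<longlongrightarrow> (2 * pi) ^ DIM('a) * \<Phi> a) (at_right 0)"
    by (rule gauss_approximate_identity)
  moreover have "\<forall>\<^sub>F \<epsilon> in at_right 0. (LINT x|lborel. \<Phi> x * gauss_kernel \<epsilon> (x - a)) = mollified h \<epsilon> a"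
    using eventually_at_right_less[of 0] by eventually_elim (rule symbol_mollified[OF \<Phi>])
  ultimately show ?thesis by (rule Lim_transform_eventually)
qed

lemma symbol_unique:
  assumes "has_symbol \<Phi> h" "has_symbol \<Psi> h" "a \<noteq> 0"
  shows "\<Phi> a = \<Psi> a"
  using tendsto_unique[OF _ symbol_inversion[OF assms(1,3)] symbol_inversion[OF assms(2,3)]] by simp

lemma symbol_antimono:
  assumes \<Phi>: "has_symbol \<Phi> h" and h: "cm_on 0 h" and "a \<noteq> 0" "norm a \<le> norm b"
  shows "\<Phi> b \<le> \<Phi> a"
proof -
  have b: "b \<noteq> 0" using assms by auto
  have "\<forall>\<^sub>F \<epsilon> in at_right 0. mollified h \<epsilon> b \<le> mollified h \<epsilon> a"
    using eventually_at_right_less[of 0] by eventually_elim (rule mollified_antimono[OF h _ assms(4)])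
  then show ?thesis
    using tendsto_le[OF _ symbol_inversion[OF \<Phi> assms(3)] symbol_inversion[OF \<Phi> b]] by simp
qed

text \<open>
  If \<open>\<Phi> c = 0\<close>, the interpolation inequality with \<open>a = b / 2\<close> reads \<open>\<Phi> b \<le> x \<Phi> (b / 2)\<close> for every
  \<open>x > 0\<close>, whenever \<open>|b| < |c|\<close>. So \<open>\<Phi>\<close> vanishes off the origin, against its positive mass \<open>h 0\<close>.
\<close>
lemma symbol_pos:
  fixes c :: "'a::euclidean_space"
  assumes \<Phi>: "has_symbol \<Phi> h" and h: "cm_on 0 h" "h 0 \<noteq> 0" and c: "c \<noteq> 0"
  shows "0 < \<Phi> c"
proof (rule ccontr)
  assume "\<not> 0 < \<Phi> c"
  then have z: "\<Phi> c = 0" using has_symbolD(1)[OF \<Phi>, of c] by simp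
  have vanish: "\<Phi> b = 0" if b: "b \<noteq> 0" for b
  proof (cases "norm c \<le> norm b")
    case True
    then show ?thesis using symbol_antimono[OF \<Phi> h(1) c True] has_symbolD(1)[OF \<Phi>, of b] z by simp
  next
    case False
    let ?a = "(1 / 2) *\<^sub>R b"
    have a: "?a \<noteq> 0" "norm ?a < norm b" using b by auto
    have "\<Phi> b \<le> x * \<Phi> ?a" if x: "0 < x" for x
    proof -
      obtain N where N: "\<And>\<epsilon>. 0 < \<epsilon> \<Longrightarrow> mollified h \<epsilon> b \<le> x * mollified h \<epsilon> ?a + N * mollified h \<epsilon> c"
        using mollified_interpolation[OF h(1) a(2) _ x, of c] False by auto
      have "((\<lambda>\<epsilon>. x * mollified h \<epsilon> ?a + N * mollified h \<epsilon> c) \<longlongrightarrow>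
          x * ((2 * pi) ^ DIM('a) * \<Phi> ?a) + N * ((2 * pi) ^ DIM('a) * \<Phi> c)) (at_right 0)"
        by (intro tendsto_intros symbol_inversion[OF \<Phi>] a c)
      moreover have "\<forall>\<^sub>F \<epsilon> in at_right 0. mollified h \<epsilon> b \<le> x * mollified h \<epsilon> ?a + N * mollified h \<epsilon> c"
        using eventually_at_right_less[of 0] by eventually_elim (rule N)
      ultimately have "(2 * pi) ^ DIM('a) * \<Phi> b \<le> x * ((2 * pi) ^ DIM('a) * \<Phi> ?a) + N * ((2 * pi) ^ DIM('a) * \<Phi> c)"
        by (intro tendsto_le[OF _ _ symbol_inversion[OF \<Phi> b]]) auto
      then have "(2 * pi) ^ DIM('a) * \<Phi> b \<le> (2 * pi) ^ DIM('a) * (x * \<Phi> ?a)"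
        using z by (simp add: mult.left_commute)
      then show ?thesis by simp
    qed
    then have "\<forall>\<^sub>F x in at_right 0. \<Phi> b \<le> x * \<Phi> ?a"
      using eventually_at_right_less[of 0] by (auto elim: eventually_mono)
    moreover have "((\<lambda>x. x * \<Phi> ?a) \<longlongrightarrow> 0 * \<Phi> ?a) (at_right 0)"
      by (intro tendsto_intros)
    ultimately have "\<Phi> b \<le> 0 * \<Phi> ?a"
      by (intro tendsto_lowerbound) auto
    then show ?thesis using has_symbolD(1)[OF \<Phi>, of b] by simp
  qed
  have "AE x in lborel. (x::'a) \<noteq> 0" by (rule AE_lborel_singleton)
  then have "(LINT x|lborel. \<Phi> x * cos (0 \<bullet> x)) = (LINT x|(lborel::'a measure). 0)"
    using borel_measurable_integrable[OF has_symbolD(2)[OF \<Phi>]]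
    by (intro integral_cong_AE) (auto elim!: eventually_mono simp: vanish)
  then show False using has_symbolD(4)[OF \<Phi>, of 0] h(2) by simp
qed

lemma symbol_bounded:
  fixes \<Phi> :: "'a::euclidean_space \<Rightarrow> real"
  assumes \<Phi>: "has_symbol \<Phi> h" and h: "cm_on 0 h" "integrable lborel (\<lambda>\<xi>::'a. h ((norm \<xi>)\<^sup>2))"
  shows "\<exists>B. \<forall>a. a \<noteq> 0 \<longrightarrow> \<Phi> a \<le> B"
proof -
  let ?I = "LINT \<xi>::'a|lborel. h ((norm \<xi>)\<^sup>2)"
  have "\<Phi> a \<le> ?I / (2 * pi) ^ DIM('a)" if a: "a \<noteq> 0" for a
  proof -
    have "mollified h \<epsilon> a \<le> ?I" if \<epsilon>: "0 < \<epsilon>" for \<epsilon>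
      unfolding mollified_def
    proof (rule integral_mono[OF mollified_integrable[OF h(1) \<epsilon>] h(2)])
      fix \<xi> :: 'a
      have "exp (- \<epsilon> * (norm \<xi>)\<^sup>2) * cos (\<xi> \<bullet> a) \<le> 1 * 1"
        using \<epsilon> by (intro order_trans[OF mult_left_mono[OF cos_le_one]]) auto
      then show "h ((norm \<xi>)\<^sup>2) * (exp (- \<epsilon> * (norm \<xi>)\<^sup>2) * cos (\<xi> \<bullet> a)) \<le> h ((norm \<xi>)\<^sup>2)"
        using cm_nonneg[OF h(1), of "(norm \<xi>)\<^sup>2"] by (intro mult_left_le) auto
    qed
    then have "\<forall>\<^sub>F \<epsilon> in at_right 0. mollified h \<epsilon> a \<le> ?I"
      using eventually_at_right_less[of 0] by (auto elim: eventually_mono)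
    then have "(2 * pi) ^ DIM('a) * \<Phi> a \<le> ?I"
      by (intro tendsto_upperbound[OF symbol_inversion[OF \<Phi> a]]) auto
    then show ?thesis by (simp add: field_simps)
  qed
  then show ?thesis by blast
qed

text \<open>
  The decay of the mollification passes to \<open>\<Phi>\<close> because \<open>\<Phi>\<close> is radially nonincreasing: its average over
  a unit ball inside the ball of radius \<open>|a|\<close> is at least \<open>\<Phi> a\<close>.
\<close>
lemma symbol_decay:
  fixes \<Phi> :: "'a::euclidean_space \<Rightarrow> real"
  assumes \<Phi>: "has_symbol \<Phi> h" and h: "cm_on (y\<^sup>2) h" and y: "0 \<le> y"
  shows "\<exists>C. \<forall>a. 1 \<le> norm a \<longrightarrow> \<Phi> a \<le> C * exp (- y * norm a)"
proof -
  let ?V = "measure lborel (ball (0::'a) 1)"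
  have V: "0 < ?V" by (simp add: content_ball_pos)
  have h0: "cm_on 0 h" using cm_weaken[OF h] by simp
  define \<kappa> where "\<kappa> = sqrt pi ^ DIM('a) * exp (- 1 / 4 :: real)"
  have \<kappa>: "0 < \<kappa>" by (simp add: \<kappa>_def)
  define C where "C = sqrt (pi / 1) ^ DIM('a) * exp (y\<^sup>2 * 1 + y) * h (- (y\<^sup>2)) / (\<kappa> * ?V)"
  have "\<Phi> a \<le> C * exp (- y * norm a)" if a: "1 \<le> norm a" for a
  proof -
    \<comment> \<open>The unit ball around \<open>?b\<close> touches the sphere of radius \<open>|a|\<close> from inside.\<close>
    let ?b = "((norm a - 1) / norm a) *\<^sub>R a"
    have "a \<noteq> 0" using a by auto
    then have b: "norm ?b = norm a - 1" using a by simp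
    have "?V = measure lborel (ball ?b 1)" by (simp add: content_ball)
    then have "\<Phi> a * \<kappa> * ?V = (LINT x|lborel. (\<Phi> a * \<kappa>) * indicator (ball ?b 1) x)"
      by simp
    also have "\<dots> \<le> (LINT x|lborel. \<Phi> x * gauss_kernel 1 (x - ?b))"
    proof (rule integral_mono_AE)
      show "integrable lborel (\<lambda>x. (\<Phi> a * \<kappa>) * indicator (ball ?b 1) x)"
        by (rule integrable_mult_right, rule integrable_real_indicator)
          (use emeasure_bounded_finite[OF bounded_ball, of ?b 1] in auto)
      show "integrable lborel (\<lambda>x. \<Phi> x * gauss_kernel 1 (x - ?b))"
      proof (rule Bochner_Integration.integrable_bound)
        show "integrable lborel (\<lambda>x. \<Phi> x * sqrt pi ^ DIM('a))"
          by (rule integrable_mult_left) (rule has_symbolD(2)[OF \<Phi>])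
        have [measurable]: "\<Phi> \<in> borel_measurable borel"
          using borel_measurable_integrable[OF has_symbolD(2)[OF \<Phi>]] by simp
        show "(\<lambda>x. \<Phi> x * gauss_kernel 1 (x - ?b)) \<in> borel_measurable lborel"
          unfolding gauss_kernel_def by measurable
        show "AE x in lborel. norm (\<Phi> x * gauss_kernel 1 (x - ?b)) \<le> norm (\<Phi> x * sqrt pi ^ DIM('a))"
          by (intro AE_I2) (auto simp: gauss_kernel_def abs_mult intro!: mult_left_mono mult_left_le)
      qed
      have "AE x in lborel. (x::'a) \<noteq> 0" by (rule AE_lborel_singleton)
      then show "AE x in lborel. (\<Phi> a * \<kappa>) * indicator (ball ?b 1) x \<le> \<Phi> x * gauss_kernel 1 (x - ?b)"
      proof eventually_elim
        case (elim x)
        show ?case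
        proof (cases "x \<in> ball ?b 1")
          case True
          then have d: "norm (x - ?b) < 1" by (simp add: dist_norm norm_minus_commute)
          then have "norm x \<le> norm a"
            using norm_triangle_ineq[of "x - ?b" ?b] b by simp
          then have "\<Phi> a \<le> \<Phi> x" by (rule symbol_antimono[OF \<Phi> h0 elim])
          moreover have "\<kappa> \<le> gauss_kernel 1 (x - ?b)"
            unfolding \<kappa>_def gauss_kernel_def using d
            by (auto intro!: mult_left_mono simp: power_le_one)
          ultimately show ?thesis
            using True has_symbolD(1)[OF \<Phi>] \<kappa> by (auto intro!: mult_mono)
        next
          case False
          then show ?thesis using has_symbolD(1)[OF \<Phi>] by (simp add: gauss_kernel_nonneg)
        qed
      qed
    qed
    also have "\<dots> = mollified h 1 ?b" by (rule symbol_mollified[OF \<Phi>]) simp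
    also have "\<dots> \<le> sqrt (pi / 1) ^ DIM('a) * exp (y\<^sup>2 * 1 - y * norm ?b) * h (- (y\<^sup>2))"
      by (rule mollified_decay[OF h _ y]) simp
    also have "y\<^sup>2 * 1 - y * norm ?b = (y\<^sup>2 * 1 + y) + (- y * norm a)"
      unfolding b by (simp add: algebra_simps)
    finally have "\<Phi> a * (\<kappa> * ?V) \<le> sqrt (pi / 1) ^ DIM('a) * exp (y\<^sup>2 * 1 + y) * h (- (y\<^sup>2)) * exp (- y * norm a)"
      by (simp only: exp_add mult_ac)
    then show ?thesis using \<kappa> V by (simp add: C_def pos_le_divide_eq mult_ac)
  qed
  then show ?thesis by blast
qed

lemma lborel_scaling:
  fixes f :: "'a::euclidean_space \<Rightarrow> real"
  assumes f: "integrable lborel f" and c: "c \<noteq> 0"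
  shows "integrable lborel (\<lambda>x. f (c *\<^sub>R x))"
    and "(LINT x|lborel. f x) = \<bar>c\<bar> ^ DIM('a) * (LINT x|lborel. f (c *\<^sub>R x))"
proof -
  have m[measurable]: "f \<in> borel_measurable borel" using borel_measurable_integrable[OF f] by simp
  have T: "(\<lambda>x::'a. 0 + c *\<^sub>R x) \<in> lborel \<rightarrow>\<^sub>M borel" by measurable
  let ?D = "distr lborel borel (\<lambda>x::'a. 0 + c *\<^sub>R x)"
  have L: "(lborel :: 'a measure) = density ?D (\<lambda>_. ennreal (\<bar>c\<bar> ^ DIM('a)))"
    using lborel_affine[OF c, of "0::'a"] by (simp add: ennreal_power)
  have m': "f \<in> borel_measurable ?D" by measurable
  have "integrable ?D (\<lambda>x. \<bar>c\<bar> ^ DIM('a) *\<^sub>R f x)"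
    using f by (subst (asm) L, subst (asm) integrable_density[OF m']) auto
  then have "integrable ?D f" using c by simp
  then show "integrable lborel (\<lambda>x. f (c *\<^sub>R x))"
    using integrable_distr_eq[OF T m] by simp
  have "(LINT x|lborel. f x) = (LINT x|?D. \<bar>c\<bar> ^ DIM('a) *\<^sub>R f x)"
    by (subst L, subst integral_density[OF m']) auto
  also have "\<dots> = \<bar>c\<bar> ^ DIM('a) * (LINT x|?D. f x)" by simp
  also have "(LINT x|?D. f x) = (LINT x|lborel. f (0 + c *\<^sub>R x))"
    by (rule integral_distr[OF T m])
  finally show "(LINT x|lborel. f x) = \<bar>c\<bar> ^ DIM('a) * (LINT x|lborel. f (c *\<^sub>R x))" by simp
qed

lemma has_symbol_scale:
  fixes \<Phi> :: "'a::euclidean_space \<Rightarrow> real"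
  assumes \<Phi>: "has_symbol \<Phi> h" and c: "0 < c"
  shows "has_symbol (\<lambda>x. c ^ DIM('a) * \<Phi> (c *\<^sub>R x)) (\<lambda>l. h (l / c\<^sup>2))"
  unfolding has_symbol_def
proof (intro conjI allI)
  show "0 \<le> c ^ DIM('a) * \<Phi> (c *\<^sub>R x)" for x
    using c has_symbolD(1)[OF \<Phi>] by simp
  show "integrable lborel (\<lambda>x. c ^ DIM('a) * \<Phi> (c *\<^sub>R x))"
    using c by (intro integrable_mult_right lborel_scaling has_symbolD(2)[OF \<Phi>]) auto
  show "continuous_on (- {0}) (\<lambda>x. c ^ DIM('a) * \<Phi> (c *\<^sub>R x))"
    using c by (intro continuous_intros continuous_on_compose2[OF has_symbolD(3)[OF \<Phi>]]) auto
  have int: "integrable lborel (\<lambda>x. \<Phi> x * cos (\<xi> \<bullet> x))" "integrable lborel (\<lambda>x. \<Phi> x * sin (\<xi> \<bullet> x))" for \<xi>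
  proof -
    have [measurable]: "\<Phi> \<in> borel_measurable borel"
      using borel_measurable_integrable[OF has_symbolD(2)[OF \<Phi>]] by simp
    show "integrable lborel (\<lambda>x. \<Phi> x * cos (\<xi> \<bullet> x))" "integrable lborel (\<lambda>x. \<Phi> x * sin (\<xi> \<bullet> x))"
      by (rule Bochner_Integration.integrable_bound[OF has_symbolD(2)[OF \<Phi>]];
          auto simp: abs_mult intro!: mult_left_le)+
  qed
  fix \<xi> :: 'a
  let ?\<eta> = "(1 / c) *\<^sub>R \<xi>"
  have e: "?\<eta> \<bullet> (c *\<^sub>R x) = \<xi> \<bullet> x" for x using c by simp
  have n: "(norm ?\<eta>)\<^sup>2 = (norm \<xi>)\<^sup>2 / c\<^sup>2" using c by (simp add: power_divide)
  have "(LINT x|lborel. c ^ DIM('a) * \<Phi> (c *\<^sub>R x) * cos (\<xi> \<bullet> x)) = (LINT x|lborel. \<Phi> x * cos (?\<eta> \<bullet> x))"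
    using lborel_scaling(2)[OF int(1)[of ?\<eta>], of c] c unfolding e by (simp add: mult.assoc)
  then show "(LINT x|lborel. c ^ DIM('a) * \<Phi> (c *\<^sub>R x) * cos (\<xi> \<bullet> x)) = h ((norm \<xi>)\<^sup>2 / c\<^sup>2)"
    unfolding has_symbolD(4)[OF \<Phi>] n .
  have "(LINT x|lborel. c ^ DIM('a) * \<Phi> (c *\<^sub>R x) * sin (\<xi> \<bullet> x)) = (LINT x|lborel. \<Phi> x * sin (?\<eta> \<bullet> x))"
    using lborel_scaling(2)[OF int(2)[of ?\<eta>], of c] c unfolding e by (simp add: mult.assoc)
  then show "(LINT x|lborel. c ^ DIM('a) * \<Phi> (c *\<^sub>R x) * sin (\<xi> \<bullet> x)) = 0"
    unfolding has_symbolD(5)[OF \<Phi>] .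
qed

lemma has_symbol_cong:
  assumes "has_symbol \<Phi> h" "\<And>l. 0 \<le> l \<Longrightarrow> h l = h' l"
  shows "has_symbol \<Phi> h'"
  using assms unfolding has_symbol_def by simp

section \<open>The fundamental solution\<close>

lemma power2_powr_half: "0 \<le> r \<Longrightarrow> (r\<^sup>2) powr (\<beta> / 2) = r powr \<beta>" for r :: real
  by (cases "r = 0") (simp_all add: powr_powr flip: powr_numeral)

text \<open>
  The Fourier symbol of \<open>Z t\<close> as a function of \<open>l = |\<xi>|\<^sup>2\<close>, the variable in which it is completely
  monotone.
\<close>
definition diffusion_symbol :: "real \<Rightarrow> real \<Rightarrow> real \<Rightarrow> real \<Rightarrow> real" where
  "diffusion_symbol \<alpha> \<beta> t l = mittag_leffler \<alpha> (- (l powr (\<beta> / 2) * t powr \<alpha>))"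

lemma diffusion_symbol_cm:
  assumes "0 < \<alpha>" "\<alpha> \<le> 1" "0 < \<beta>" "\<beta> \<le> 2"
  shows "cm_on 0 (diffusion_symbol \<alpha> \<beta> t)"
proof -
  have "cm_on 0 (\<lambda>x. mittag_leffler \<alpha> (- (t powr \<alpha> * x)))"
    by (rule cm_rescale[OF cm_mittag_leffler[of \<alpha> 0]]) (use assms in auto)
  then have "cm_on 0 (\<lambda>x. mittag_leffler \<alpha> (- (t powr \<alpha> * x powr (\<beta> / 2))))"
    by (rule cm_compose_powr) (use assms in auto)
  then show ?thesis by (simp add: diffusion_symbol_def[abs_def] mult.commute)
qed

lemma mittag_leffler_0 [simp]: "mittag_leffler \<alpha> 0 = 1"
  using powser_zero[of "\<lambda>k. 1 / Gamma (1 + \<alpha> * real k)"] by (simp add: mittag_leffler_def)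

lemma diffusion_symbol_0 [simp]: "diffusion_symbol \<alpha> \<beta> t 0 = 1"
  by (simp add: diffusion_symbol_def)

lemma mittag_leffler_1: "mittag_leffler 1 z = exp z"
proof -
  have "z ^ k / Gamma (1 + 1 * real k) = z ^ k /\<^sub>R fact k" for k
    using Gamma_fact[of k, where 'a = real] by (simp add: divide_inverse mult.commute add.commute)
  then show ?thesis unfolding mittag_leffler_def exp_def by simp
qed

lemma fundamental_solution_symbol:
  fixes Z :: "real \<Rightarrow> real ^ 'd::finite \<Rightarrow> real"
  assumes Z: "fundamental_solution \<alpha> \<beta> Z" and t: "0 < t"
  shows "has_symbol (Z t) (diffusion_symbol \<alpha> \<beta> t)"
proof -
  have nn: "0 \<le> Z t x" and int: "integrable lebesgue (Z t)" and cont: "continuous_on (- {0}) (Z t)"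
    and ft: "fourier_transform (\<lambda>x. complex_of_real (Z t x)) \<xi> =
      complex_of_real ((2 * pi) powr (- real CARD('d) / 2) * mittag_leffler \<alpha> (- (norm \<xi> powr \<beta> * t powr \<alpha>)))" for x \<xi>
    using Z t unfolding fundamental_solution_def by auto
  have m[measurable]: "Z t \<in> borel_measurable borel"
    by (rule borel_measurable_continuous_countable_exceptions[of "{0}"]) (use cont in auto)
  have int': "integrable lborel (Z t)"
    using int integrable_completion[of "Z t" lborel] by simp
  have "(LINT x|lborel. Z t x * cos (\<xi> \<bullet> x)) = diffusion_symbol \<alpha> \<beta> t ((norm \<xi>)\<^sup>2) \<and> (LINT x|lborel. Z t x * sin (\<xi> \<bullet> x)) = 0" for \<xi>
  proof -
    let ?f = "\<lambda>x. exp (- \<i> * complex_of_real (x \<bullet> \<xi>)) * complex_of_real (Z t x)"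
    have f: "?f x = cis (- (\<xi> \<bullet> x)) * complex_of_real (Z t x)" for x
      by (simp add: cis_conv_exp inner_commute)
    have fm: "?f \<in> borel_measurable lborel"
      unfolding cis_conv_exp[symmetric] by measurable
    have fi: "integrable lborel ?f"
      by (rule Bochner_Integration.integrable_bound[OF int' fm]) (simp add: f norm_mult)
    have "(LINT x|lebesgue. ?f x) = complex_of_real (diffusion_symbol \<alpha> \<beta> t ((norm \<xi>)\<^sup>2))"
      using ft[of \<xi>] by (simp add: fourier_transform_def diffusion_symbol_def power2_powr_half)
    then have I: "(LINT x|lborel. ?f x) = complex_of_real (diffusion_symbol \<alpha> \<beta> t ((norm \<xi>)\<^sup>2))"
      using integral_completion[OF fm] by simp
    have "(LINT x|lborel. Z t x * cos (\<xi> \<bullet> x)) = (LINT x|lborel. Re (?f x))"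
      by (intro Bochner_Integration.integral_cong refl) (simp only: f, simp)
    also have "\<dots> = diffusion_symbol \<alpha> \<beta> t ((norm \<xi>)\<^sup>2)"
      unfolding integral_Re[OF fi] I by simp
    finally have re: "(LINT x|lborel. Z t x * cos (\<xi> \<bullet> x)) = diffusion_symbol \<alpha> \<beta> t ((norm \<xi>)\<^sup>2)" .
    have "(LINT x|lborel. Z t x * sin (\<xi> \<bullet> x)) = (LINT x|lborel. - Im (?f x))"
      by (intro Bochner_Integration.integral_cong refl) (simp only: f, simp)
    also have "\<dots> = 0"
      unfolding integral_minus integral_Im[OF fi] I by simp
    finally show ?thesis using re by simp
  qed
  then show ?thesis using nn int' cont by (simp add: has_symbol_def)
qed

text \<open>
  Both sides have the same symbol after rescaling. Taking two solutions \<open>Z\<close> and \<open>Z'\<close> includes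
  uniqueness, so that one constant serves every fundamental solution.
\<close>
lemma fundamental_solution_scaling:
  fixes Z Z' :: "real \<Rightarrow> real ^ 'd::finite \<Rightarrow> real"
  assumes "0 < \<alpha>" "0 < \<beta>" and Z: "fundamental_solution \<alpha> \<beta> Z" "fundamental_solution \<alpha> \<beta> Z'"
    and t: "0 < t" and x: "x \<noteq> 0"
  shows "Z t x = (1 / (t powr (\<alpha> / \<beta>)) ^ CARD('d)) * Z' 1 ((1 / t powr (\<alpha> / \<beta>)) *\<^sub>R x)"
proof -
  define c where "c = t powr (\<alpha> / \<beta>)"
  have c: "0 < c" using t by (simp add: c_def)
  have "has_symbol (\<lambda>y. c ^ DIM(real ^ 'd) * Z t (c *\<^sub>R y)) (\<lambda>l. diffusion_symbol \<alpha> \<beta> t (l / c\<^sup>2))"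
    by (rule has_symbol_scale[OF fundamental_solution_symbol[OF Z(1) t] c])
  then have "has_symbol (\<lambda>y. c ^ DIM(real ^ 'd) * Z t (c *\<^sub>R y)) (diffusion_symbol \<alpha> \<beta> 1)"
  proof (rule has_symbol_cong)
    fix l :: real assume l: "0 \<le> l"
    have "c powr \<beta> = t powr \<alpha>" using assms t by (simp add: c_def powr_powr)
    then have "(l / c\<^sup>2) powr (\<beta> / 2) * t powr \<alpha> = l powr (\<beta> / 2)"
      using l c t by (simp add: powr_divide power2_powr_half)
    then show "diffusion_symbol \<alpha> \<beta> t (l / c\<^sup>2) = diffusion_symbol \<alpha> \<beta> 1 l" by (simp add: diffusion_symbol_def)
  qed
  moreover have "has_symbol (Z' 1) (diffusion_symbol \<alpha> \<beta> 1)"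
    by (rule fundamental_solution_symbol[OF Z(2)]) simp
  ultimately have "c ^ DIM(real ^ 'd) * Z t (c *\<^sub>R ((1 / c) *\<^sub>R x)) = Z' 1 ((1 / c) *\<^sub>R x)"
    by (rule symbol_unique) (use c x in auto)
  then show ?thesis using c by (simp add: c_def[symmetric] field_simps)
qed

lemma integrable_powr_tail:
  assumes p: "1 < p"
  shows "integrable lborel (\<lambda>x::real. if \<bar>x\<bar> \<le> 1 then 1 else \<bar>x\<bar> powr (- p))"
proof -
  let ?g = "\<lambda>x::real. indicator {1..} x * x powr (- p)"
  have "(\<lambda>x. x powr (- p)) integrable_on {1..}"
    using has_integral_powr_to_inf[of "- p" 1] p by (auto simp: integrable_on_def)
  then have "(\<lambda>x. x powr (- p)) absolutely_integrable_on {1..}"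
    by (rule nonnegative_absolutely_integrable_1) simp
  then have "integrable lebesgue ?g" by (simp add: set_integrable_def)
  then have g: "integrable lborel ?g"
    by (subst (asm) integrable_completion) auto
  have g': "integrable lborel (\<lambda>x. ?g (0 + (- 1) * x))"
    using g by (subst lborel_integrable_real_affine_iff) auto
  have i: "integrable lborel (indicator {-1..1} :: real \<Rightarrow> real)" by simp
  show ?thesis
    by (rule Bochner_Integration.integrable_bound
        [OF Bochner_Integration.integrable_add[OF i Bochner_Integration.integrable_add[OF g g']]])
      (auto simp: indicator_def)
qed

text \<open>
  The majorant is a product of functions of one coordinate, because each \<open>|\<xi> \<bullet> b|\<close> is at most \<open>|\<xi>|\<close>.
\<close>
lemma integrable_radial_decay:
  fixes f :: "'a::euclidean_space \<Rightarrow> real"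
  assumes f: "f \<in> borel_measurable borel" and p: "1 < p"
    and le: "\<And>\<xi>. \<bar>f \<xi>\<bar> \<le> K * (if norm \<xi> \<le> 1 then 1 else norm \<xi> powr (- p)) ^ DIM('a)"
  shows "integrable lborel f"
proof -
  let ?m = "\<lambda>x::real. if \<bar>x\<bar> \<le> 1 then 1 else \<bar>x\<bar> powr (- p)"
  have "0 \<le> K" using le[of 0] by simp
  have mono: "?m y \<le> ?m x" if "\<bar>x\<bar> \<le> \<bar>y\<bar>" for x y
  proof (cases "\<bar>x\<bar> \<le> 1")
    case True
    then show ?thesis using p powr_mono2'[of "- p" 1 "\<bar>y\<bar>"] by (auto simp: )
  next
    case False
    then show ?thesis using that p powr_mono2'[of "- p" "\<bar>x\<bar>" "\<bar>y\<bar>"] by auto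
  qed
  have I: "integrable lborel (\<lambda>\<xi>::'a. K * (\<Prod>b\<in>Basis. ?m (\<xi> \<bullet> b)))"
    by (intro integrable_mult_right lborel_prod_Basis integrable_powr_tail p)
  show ?thesis
  proof (rule Bochner_Integration.integrable_bound[OF I])
    show "AE \<xi> in lborel. norm (f \<xi>) \<le> norm (K * (\<Prod>b\<in>Basis. ?m (\<xi> \<bullet> b)))"
    proof (rule AE_I2)
      fix \<xi> :: 'a
      have "(?m (norm \<xi>)) ^ DIM('a) = (\<Prod>b\<in>(Basis :: 'a set). ?m (norm \<xi>))" by simp
      also have "\<dots> \<le> (\<Prod>b\<in>Basis. ?m (\<xi> \<bullet> b))"
      proof (rule prod_mono)
        fix b :: 'a assume "b \<in> Basis"
        then have "\<bar>\<xi> \<bullet> b\<bar> \<le> \<bar>norm \<xi>\<bar>" by (simp add: Basis_le_norm)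
        then have "?m (norm \<xi>) \<le> ?m (\<xi> \<bullet> b)" by (rule mono)
        then show "0 \<le> ?m (norm \<xi>) \<and> ?m (norm \<xi>) \<le> ?m (\<xi> \<bullet> b)" by auto
      qed
      finally have "K * (?m (norm \<xi>)) ^ DIM('a) \<le> K * (\<Prod>b\<in>Basis. ?m (\<xi> \<bullet> b))"
        using \<open>0 \<le> K\<close> by (rule mult_left_mono)
      then have "\<bar>f \<xi>\<bar> \<le> K * (\<Prod>b\<in>Basis. ?m (\<xi> \<bullet> b))"
        using le[of \<xi>] by (simp only: abs_norm_cancel)
      then show "norm (f \<xi>) \<le> norm (K * (\<Prod>b\<in>Basis. ?m (\<xi> \<bullet> b)))"
        unfolding real_norm_def by (rule order_trans) (rule abs_ge_self)
    qed
  qed (use f in simp)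
qed

text \<open>
  In dimension one \<open>mittag_leffler_decay\<close> and \<open>\<beta> > 1\<close> suffice. For \<open>\<alpha> = 1\<close> the symbol
  \<open>e\<^bsup>-|\<xi>|^\<beta>\<^esup>\<close> decays faster than every power.
\<close>
lemma diffusion_symbol_integrable:
  assumes "0 < \<alpha>" "\<alpha> \<le> 1" "0 < \<beta>" "\<beta> \<le> 2"
    and c: "(\<alpha> \<noteq> 1 \<and> CARD('d::finite) = 1 \<and> 1 < \<beta>) \<or> (\<alpha> = 1 \<and> \<beta> \<noteq> 2)"
  shows "integrable lborel (\<lambda>\<xi>::real ^ 'd. diffusion_symbol \<alpha> \<beta> 1 ((norm \<xi>)\<^sup>2))"
proof -
  note cm = diffusion_symbol_cm[OF assms(1-4), of 1]
  have bd: "\<bar>diffusion_symbol \<alpha> \<beta> 1 ((norm \<xi>)\<^sup>2)\<bar> \<le> 1" for \<xi> :: "real ^ 'd"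
    using cm_norm_bound[OF cm, of \<xi>] by simp
  have sy: "diffusion_symbol \<alpha> \<beta> 1 ((norm \<xi>)\<^sup>2) = mittag_leffler \<alpha> (- (norm \<xi> powr \<beta>))" for \<xi> :: "real ^ 'd"
    by (simp add: diffusion_symbol_def power2_powr_half)
  have nn: "0 \<le> diffusion_symbol \<alpha> \<beta> 1 ((norm \<xi>)\<^sup>2)" for \<xi> :: "real ^ 'd"
    by (rule cm_nonneg[OF cm]) simp
  from c show ?thesis
  proof
    assume a: "\<alpha> \<noteq> 1 \<and> CARD('d::finite) = 1 \<and> 1 < \<beta>"
    show ?thesis
    proof (rule integrable_radial_decay[where p = \<beta> and K = "max 1 (Gamma (1 + \<alpha>))"])
      fix \<xi> :: "real ^ 'd"
      show "\<bar>diffusion_symbol \<alpha> \<beta> 1 ((norm \<xi>)\<^sup>2)\<bar> \<le> max 1 (Gamma (1 + \<alpha>)) *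
          (if norm \<xi> \<le> 1 then 1 else norm \<xi> powr (- \<beta>)) ^ DIM(real ^ 'd)"
      proof (cases "norm \<xi> \<le> 1")
        case True
        then show ?thesis using bd[of \<xi>] by simp
      next
        case False
        then have pos: "0 < norm \<xi> powr \<beta>" by auto
        have "\<bar>diffusion_symbol \<alpha> \<beta> 1 ((norm \<xi>)\<^sup>2)\<bar> = mittag_leffler \<alpha> (- (norm \<xi> powr \<beta>))"
          using nn[of \<xi>] unfolding sy by simp
        also have "\<dots> \<le> Gamma (1 + \<alpha>) / norm \<xi> powr \<beta>"
          by (rule mittag_leffler_decay[OF assms(1,2) pos])
        also have "\<dots> = Gamma (1 + \<alpha>) * norm \<xi> powr (- \<beta>)"
          by (simp add: powr_minus divide_inverse)
        also have "\<dots> \<le> max 1 (Gamma (1 + \<alpha>)) * norm \<xi> powr (- \<beta>)"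
          by (intro mult_right_mono) auto
        finally show ?thesis using False a by simp
      qed
    qed (use a cm_norm_measurable[OF cm] in auto)
  next
    assume b: "\<alpha> = 1 \<and> \<beta> \<noteq> 2"
    \<comment> \<open>The bound \<open>e\<^bsup>-v\<^esup> \<le> (m / v)\<^sup>m\<close> at \<open>v = |\<xi>|\<^bsup>\<beta>\<^esup>\<close> gives the power \<open>|\<xi>|\<^bsup>-2d\<^esup>\<close> once \<open>m \<beta> \<ge> 2d\<close>.\<close>
    define m where "m = nat \<lceil>2 * real CARD('d) / \<beta>\<rceil>"
    have "2 * real CARD('d) / \<beta> \<le> real m" unfolding m_def by linarith
    then have m: "2 * real CARD('d) \<le> \<beta> * real m"
      using assms(3) by (simp add: field_simps)
    have "0 < \<beta> * real m" by (rule less_le_trans[OF _ m]) simp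
    then have m0: "0 < real m" using assms(3) by (simp add: zero_less_mult_iff)
    show ?thesis
    proof (rule integrable_radial_decay[where p = 2 and K = "max 1 (real m ^ m)"])
      fix \<xi> :: "real ^ 'd"
      show "\<bar>diffusion_symbol \<alpha> \<beta> 1 ((norm \<xi>)\<^sup>2)\<bar> \<le> max 1 (real m ^ m) *
          (if norm \<xi> \<le> 1 then 1 else norm \<xi> powr (- 2)) ^ DIM(real ^ 'd)"
      proof (cases "norm \<xi> \<le> 1")
        case True
        then show ?thesis using bd[of \<xi>] by simp
      next
        case False
        let ?x = "norm \<xi> powr \<beta>"
        have pos: "0 < ?x" using False by auto
        have "\<bar>diffusion_symbol \<alpha> \<beta> 1 ((norm \<xi>)\<^sup>2)\<bar> = exp (- ?x)"
          unfolding sy using b by (simp add: mittag_leffler_1)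
        also have "\<dots> = (1 / exp (?x / real m)) ^ m"
          using m0 by (simp add: power_one_over exp_of_nat_mult[symmetric] exp_minus inverse_eq_divide)
        also have "\<dots> \<le> (1 / (?x / real m)) ^ m"
        proof (intro power_mono divide_left_mono)
          show "?x / real m \<le> exp (?x / real m)"
            using exp_ge_add_one_self[of "?x / real m"] by linarith
        qed (use pos m0 in auto)
        also have "\<dots> = real m ^ m * norm \<xi> powr (- (\<beta> * real m))"
        proof -
          have "?x ^ m = norm \<xi> powr (\<beta> * real m)"
            using pos by (simp add: powr_powr flip: powr_realpow)
          then show ?thesis
            by (simp add: powr_minus divide_inverse power_mult_distrib power_inverse mult.commute)
        qed
        also have "\<dots> \<le> max 1 (real m ^ m) * norm \<xi> powr (- (2 * real CARD('d)))"
          using m False by (intro mult_mono powr_mono) auto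
        also have "norm \<xi> powr (- (2 * real CARD('d))) = (norm \<xi> powr (- 2)) ^ CARD('d)"
          using False by (subst powr_realpow[symmetric]) (auto simp: powr_powr)
        finally show ?thesis using False by simp
      qed
    qed (use cm_norm_measurable[OF cm] in auto)
  qed
qed

section \<open>Comparison of the kernels at two times\<close>

lemma integrable_reflected:
  fixes f :: "'a::euclidean_space \<Rightarrow> real"
  assumes "integrable lborel f"
  shows "integrable lborel (\<lambda>y. f (x - y))"
  using lborel_translation(1)[OF lborel_scaling(1)[OF assms, of "- 1"], of x] by simp

lemma integrable_lborel_lebesgue:
  fixes f :: "'a::euclidean_space \<Rightarrow> real"
  assumes "integrable lborel f"
  shows "integrable lebesgue f"
  using assms integrable_completion[of f lborel] borel_measurable_integrable[OF assms] by simp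

lemma AE_lebesgue_neq: "AE y in lebesgue. (y :: 'a::euclidean_space) \<noteq> x"
  by (rule AE_completion) (rule AE_lborel_singleton)

text \<open>
  The radius \<open>R = 1 / (\<sigma> - 1)\<close> is the fixed point of \<open>r \<mapsto> (r + 1) / \<sigma>\<close>, and the rescaled arguments
  satisfy \<open>|w| \<le> (|z| + 1) / \<sigma>\<close>. If \<open>|z| \<ge> R\<close>, then \<open>|w| \<le> |z|\<close>; otherwise \<open>|w| \<le> R\<close>.
\<close>
lemma harnack_kernel:
  fixes Z :: "real \<Rightarrow> real ^ 'd::finite \<Rightarrow> real" and \<Phi> :: "real ^ 'd \<Rightarrow> real"
  assumes \<kappa>: "0 < \<kappa>"
    and scaling: "\<And>t x. 0 < t \<Longrightarrow> x \<noteq> 0 \<Longrightarrow> Z t x = (1 / (t powr \<kappa>) ^ CARD('d)) * \<Phi> ((1 / t powr \<kappa>) *\<^sub>R x)"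
    and anti: "\<And>a b. a \<noteq> 0 \<Longrightarrow> norm a \<le> norm b \<Longrightarrow> \<Phi> b \<le> \<Phi> a"
    and pos: "\<And>a. a \<noteq> 0 \<Longrightarrow> 0 < \<Phi> a"
    and bound: "\<And>a. a \<noteq> 0 \<Longrightarrow> \<Phi> a \<le> B"
    and e: "norm e = 1"
    and t: "0 < t1" "t1 < t2"
    and x: "dist x1 x2 \<le> t1 powr \<kappa>" "y \<noteq> x1" "y \<noteq> x2"
  shows "Z t1 (x1 - y) \<le> ((t2 / t1) powr \<kappa>) ^ CARD('d) * (1 + B / \<Phi> ((1 / ((t2 / t1) powr \<kappa> - 1)) *\<^sub>R e)) * Z t2 (x2 - y)"
proof -
  define c1 c2 \<sigma> where "c1 = t1 powr \<kappa>" and "c2 = t2 powr \<kappa>" and "\<sigma> = (t2 / t1) powr \<kappa>"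
  have c: "0 < c1" "0 < c2" using t by (auto simp: c1_def c2_def)
  have c2: "c2 = \<sigma> * c1" using t by (simp add: c1_def c2_def \<sigma>_def powr_divide)
  have \<sigma>: "1 < \<sigma>" using t \<kappa> by (simp add: \<sigma>_def)
  define z w where "z = (1 / c1) *\<^sub>R (x1 - y)" and "w = (1 / c2) *\<^sub>R (x2 - y)"
  have z: "z \<noteq> 0" and w: "w \<noteq> 0" using c x by (auto simp: z_def w_def)
  define R where "R = 1 / (\<sigma> - 1)"
  have R: "0 < R" "(R + 1) / \<sigma> = R" using \<sigma> by (auto simp: R_def field_simps)
  have Re: "norm (R *\<^sub>R e) = R" "R *\<^sub>R e \<noteq> 0" using R e by auto
  have B: "0 < B" using pos[OF Re(2)] bound[OF Re(2)] by linarith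
  have wz: "norm w \<le> (norm z + 1) / \<sigma>"
  proof -
    have "norm (x2 - y) \<le> norm (x1 - y) + c1"
      using norm_triangle_ineq[of "x1 - y" "x2 - x1"] x(1) by (simp add: dist_norm norm_minus_commute c1_def)
    then have "norm (x2 - y) / c1 \<le> norm (x1 - y) / c1 + 1"
      using c by (simp add: field_simps)
    then have "norm (x2 - y) / c1 / \<sigma> \<le> (norm (x1 - y) / c1 + 1) / \<sigma>"
      using \<sigma> by (intro divide_right_mono) auto
    then show ?thesis using c \<sigma> by (simp add: w_def z_def c2 mult.commute)
  qed
  have "\<Phi> z \<le> (1 + B / \<Phi> (R *\<^sub>R e)) * \<Phi> w"
  proof (cases "R \<le> norm z")
    case True
    have "1 \<le> norm z * (\<sigma> - 1)" using True \<sigma> by (simp add: R_def field_simps)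
    then have "(norm z + 1) / \<sigma> \<le> norm z" using \<sigma> by (simp add: field_simps)
    then have "\<Phi> z \<le> 1 * \<Phi> w" using anti[OF w, of z] wz by simp
    also have "\<dots> \<le> (1 + B / \<Phi> (R *\<^sub>R e)) * \<Phi> w"
      using pos[OF w] pos[OF Re(2)] B by (intro mult_right_mono) auto
    finally show ?thesis .
  next
    case False
    then have "(norm z + 1) / \<sigma> \<le> (R + 1) / \<sigma>" using \<sigma> by (intro divide_right_mono) auto
    then have "norm w \<le> norm (R *\<^sub>R e)" using wz R(2) Re(1) by simp
    then have "\<Phi> (R *\<^sub>R e) \<le> \<Phi> w" by (rule anti[OF w])
    have "\<Phi> z \<le> B / \<Phi> (R *\<^sub>R e) * \<Phi> (R *\<^sub>R e)" using bound[OF z] pos[OF Re(2)] by simp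
    also have "\<dots> \<le> B / \<Phi> (R *\<^sub>R e) * \<Phi> w"
      using \<open>\<Phi> (R *\<^sub>R e) \<le> \<Phi> w\<close> pos[OF Re(2)] B by (intro mult_left_mono) auto
    also have "\<dots> \<le> (1 + B / \<Phi> (R *\<^sub>R e)) * \<Phi> w"
      using pos[OF w] by (intro mult_right_mono) auto
    finally show ?thesis .
  qed
  then have "(1 / c1 ^ CARD('d)) * \<Phi> z \<le> (1 / c1 ^ CARD('d)) * ((1 + B / \<Phi> (R *\<^sub>R e)) * \<Phi> w)"
    using c by (intro mult_left_mono) auto
  also have "\<dots> = \<sigma> ^ CARD('d) * (1 + B / \<Phi> (R *\<^sub>R e)) * ((1 / c2 ^ CARD('d)) * \<Phi> w)"
    using \<sigma> by (simp add: c2 power_mult_distrib)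
  also have "(1 / c2 ^ CARD('d)) * \<Phi> w = Z t2 (x2 - y)"
    using scaling[of t2 "x2 - y"] t x by (simp add: w_def c2_def)
  also have "(1 / c1 ^ CARD('d)) * \<Phi> z = Z t1 (x1 - y)"
    using scaling[of t1 "x1 - y"] t x by (simp add: z_def c1_def)
  finally show ?thesis by (simp add: R_def \<sigma>_def)
qed

lemma harnack_constantI:
  fixes Z :: "real \<Rightarrow> real ^ 'd::finite \<Rightarrow> real"
  assumes "0 < \<alpha>" "0 < \<beta>"
    and kernel: "\<And>t1 t2 x1 x2 y. 0 < t1 \<Longrightarrow> t1 < t2 \<Longrightarrow> dist x1 x2 \<le> t1 powr (\<alpha> / \<beta>) \<Longrightarrow>
      y \<noteq> x1 \<Longrightarrow> y \<noteq> x2 \<Longrightarrow> Z t1 (x1 - y) \<le> C (t2 / t1) * Z t2 (x2 - y)"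
  shows "harnack_constant \<alpha> \<beta> Z C"
  unfolding harnack_constant_def
proof (intro allI impI)
  fix r T t1 t2 :: real and x1 x2 :: "real ^ 'd" and u0 u
  assume r: "0 < r" and x: "x1 \<in> ball 0 r" "x2 \<in> ball (0 :: real ^ 'd) r" and u0: "\<forall>x. 0 \<le> u0 x"
    and u: "mild_solution Z T u0 u" and t1: "(2 * r) powr (\<beta> / \<alpha>) \<le> t1" and t12: "t1 < t2"
    and t2: "t2 \<le> t1 + (2 * r) powr (\<beta> / \<alpha>)" and T: "t1 + (2 * r) powr (\<beta> / \<alpha>) \<le> T"
  have p: "0 < (2 * r) powr (\<beta> / \<alpha>)" using r by simp
  then have t: "0 < t1" "0 < t2" "t1 \<le> T" "t2 \<le> T" using t1 t12 t2 T by linarith+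
  have "((2 * r) powr (\<beta> / \<alpha>)) powr (\<alpha> / \<beta>) \<le> t1 powr (\<alpha> / \<beta>)"
    using t1 assms by (intro powr_mono2) auto
  then have "2 * r \<le> t1 powr (\<alpha> / \<beta>)" using assms r by (simp add: powr_powr)
  moreover have "dist x1 x2 \<le> 2 * r"
    using x dist_triangle[of x1 x2 0] by (simp add: dist_commute)
  ultimately have d: "dist x1 x2 \<le> t1 powr (\<alpha> / \<beta>)" by linarith
  have i: "integrable lebesgue (\<lambda>y. Z t (x - y) * u0 y)" "u t x = (LINT y|lebesgue. Z t (x - y) * u0 y)"
    if "0 < t" "t \<le> T" for t x
    using u that by (auto simp: mild_solution_def)
  have "u t1 x1 = (LINT y|lebesgue. Z t1 (x1 - y) * u0 y)" by (rule i(2)[OF t(1,3)])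
  also have "\<dots> \<le> (LINT y|lebesgue. C (t2 / t1) * (Z t2 (x2 - y) * u0 y))"
  proof (rule integral_mono_AE)
    show "AE y in lebesgue. Z t1 (x1 - y) * u0 y \<le> C (t2 / t1) * (Z t2 (x2 - y) * u0 y)"
      using AE_lebesgue_neq[of x1] AE_lebesgue_neq[of x2]
    proof eventually_elim
      case (elim y)
      have "Z t1 (x1 - y) * u0 y \<le> (C (t2 / t1) * Z t2 (x2 - y)) * u0 y"
        using u0 by (intro mult_right_mono kernel t t12 d elim) auto
      then show ?case by (simp add: mult.assoc)
    qed
  qed (use i(1)[OF t(1,3)] i(1)[OF t(2,4)] in auto)
  also have "\<dots> = C (t2 / t1) * u t2 x2" by (simp add: i(2)[OF t(2,4)])
  finally show "u t1 x1 \<le> C (t2 / t1) * u t2 x2" .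
qed

section \<open>Blow-up of the constant\<close>

text \<open>
  A bound \<open>f r \<le> N f (r + h)\<close> iterates to \<open>f (1 + nh) \<ge> N\<^bsup>-n\<^esup> f 1\<close>, which is only exponential decay.
\<close>
lemma superexponential_ratio_unbounded:
  fixes f :: "real \<Rightarrow> real"
  assumes pos: "\<And>r. 1 \<le> r \<Longrightarrow> 0 < f r" and h: "0 < h"
    and decay: "\<And>y. 0 \<le> y \<Longrightarrow> \<exists>C. \<forall>r\<ge>1. f r \<le> C * exp (- y * r)"
  shows "\<exists>r\<ge>1. M * f (r + h) < f r"
proof (rule ccontr)
  assume "\<not> ?thesis"
  then have le: "f r \<le> M * f (r + h)" if "1 \<le> r" for r using that by force
  \<comment> \<open>The iteration needs a positive factor, whatever the sign of \<open>M\<close>.\<close>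
  define N where "N = max M 1"
  have N: "1 \<le> N" "0 < N" by (auto simp: N_def)
  have le': "f r \<le> N * f (r + h)" if "1 \<le> r" for r
  proof -
    have "M * f (r + h) \<le> N * f (r + h)"
      using pos[of "r + h"] that h by (intro mult_right_mono) (auto simp: N_def)
    then show ?thesis using le[OF that] by linarith
  qed
  have iter: "f 1 \<le> N ^ n * f (1 + real n * h)" for n
  proof (induction n)
    case (Suc n)
    have "f (1 + real n * h) \<le> N * f (1 + real n * h + h)" using h by (intro le') auto
    then have "N ^ n * f (1 + real n * h) \<le> N ^ n * (N * f (1 + real n * h + h))"
      using N by (intro mult_left_mono) auto
    with Suc show ?case by (simp add: algebra_simps)
  qed simp
  \<comment> \<open>At this rate each step of length \<open>h\<close> costs a factor \<open>N e\<close>.\<close>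
  define y where "y = (ln N + 1) / h"
  have y: "0 \<le> y" "y * h = ln N + 1" using N h by (auto simp: y_def)
  obtain C where C: "\<And>r. 1 \<le> r \<Longrightarrow> f r \<le> C * exp (- y * r)" using decay[OF y(1)] by blast
  have "f 1 \<le> C * exp (- y) * exp (- 1) ^ n" for n
  proof -
    have "N ^ n = exp (real n * ln N)" using N by (simp add: exp_of_nat_mult)
    moreover have "exp (real n * ln N) * exp (- y * (1 + real n * h)) = exp (- y) * exp (- 1) ^ n"
    proof -
      have "y * (1 + real n * h) = y + real n * (y * h)" by (simp add: algebra_simps)
      then have "real n * ln N + - y * (1 + real n * h) = - y + real n * - 1"
        unfolding y(2) by (simp add: algebra_simps)
      then show ?thesis by (simp only: exp_add[symmetric] exp_of_nat_mult[symmetric])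
    qed
    moreover have "N ^ n * f (1 + real n * h) \<le> N ^ n * (C * exp (- y * (1 + real n * h)))"
      using N h by (intro mult_left_mono C) auto
    ultimately show ?thesis using iter[of n] by (simp add: mult_ac)
  qed
  moreover have "(\<lambda>n. C * exp (- y) * exp (- 1 :: real) ^ n) \<longlonglongrightarrow> C * exp (- y) * 0"
    by (intro tendsto_mult_left LIMSEQ_power_zero) simp
  ultimately have "f 1 \<le> C * exp (- y) * 0"
    by (intro LIMSEQ_le_const[of _ "C * exp (- y) * 0" "f 1"]) auto
  then show False using pos[of 1] by simp
qed

text \<open>
  The initial datum is the indicator of a ball of radius \<open>1 / 16\<close> on the ray through \<open>- e\<close>, with
  \<open>t1 = 1\<close>, \<open>t2 = s\<close>, and the solution is evaluated at \<open>0\<close> and at \<open>e / 4\<close>. Monotonicity replaces \<open>\<Phi>\<close> by its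
  extreme values over the ball; the condition on \<open>s\<close> keeps the dilation by \<open>s\<^bsup>-\<kappa>\<^esup>\<close> from
  consuming the gain in distance.
\<close>
lemma harnack_constant_kernel:
  fixes Z :: "real \<Rightarrow> real ^ 'd::finite \<Rightarrow> real" and \<Phi> :: "real ^ 'd \<Rightarrow> real"
  assumes H: "harnack_constant \<alpha> \<beta> Z C" and \<kappa>: "0 < \<kappa>"
    and nn: "\<And>t x. 0 < t \<Longrightarrow> 0 \<le> Z t x"
    and int: "\<And>t. 0 < t \<Longrightarrow> integrable lborel (Z t)"
    and scaling: "\<And>t x. 0 < t \<Longrightarrow> x \<noteq> 0 \<Longrightarrow> Z t x = (1 / (t powr \<kappa>) ^ CARD('d)) * \<Phi> ((1 / t powr \<kappa>) *\<^sub>R x)"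
    and anti: "\<And>a b. a \<noteq> 0 \<Longrightarrow> norm a \<le> norm b \<Longrightarrow> \<Phi> b \<le> \<Phi> a"
    and pos: "\<And>a. a \<noteq> 0 \<Longrightarrow> 0 < \<Phi> a"
    and e: "norm e = 1"
    and s: "1 < s" "s \<le> 2" and \<rho>: "1 \<le> \<rho>" "s powr \<kappa> * (\<rho> + 1 / 16) \<le> \<rho> + 1 / 8"
  shows "\<Phi> (\<rho> *\<^sub>R e) \<le> C s * \<Phi> ((\<rho> + 1 / 16) *\<^sub>R e)"
proof -
  define y0 where "y0 = (1 / 16 - \<rho>) *\<^sub>R e"
  define A where "A = ball y0 (1 / 16)"
  define u0 where "u0 = (indicator A :: real ^ 'd \<Rightarrow> real)"
  define u where "u t x = (if t = 0 then u0 x else LINT y|lebesgue. Z t (x - y) * u0 y)" for t x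
  let ?x2 = "(1 / 4) *\<^sub>R e"
  let ?V = "measure lebesgue A"
  have A: "A \<in> sets lborel" "A \<in> sets lebesgue" by (auto simp: A_def)
  have iA: "integrable lebesgue (\<lambda>y. k * u0 y)" for k
    unfolding u0_def
    by (intro integrable_mult_right integrable_lborel_lebesgue integrable_real_indicator)
      (use emeasure_bounded_finite[OF bounded_ball, of y0 "1 / 16"] in \<open>auto simp: A_def\<close>)
  have V: "0 < ?V" by (simp add: A_def content_ball_pos)
  have LV: "(LINT y|lebesgue. k * u0 y) = k * ?V" for k
    by (simp add: u0_def)
  have iZ: "integrable lebesgue (\<lambda>y. Z t (x - y) * u0 y)" if "0 < t" for t x
    unfolding u0_def
    by (intro integrable_lborel_lebesgue integrable_real_mult_indicator A integrable_reflected int that)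
  have mild: "mild_solution Z 2 u0 u"
    unfolding mild_solution_def using iZ by (simp add: u_def)
  have main: "u 1 0 \<le> C (s / 1) * u s ?x2"
    by (rule H[unfolded harnack_constant_def, rule_format, where r = "1 / 2" and T = 2 and ?u0.0 = u0])
      (use mild s e in \<open>auto simp: u0_def\<close>)
  have lower: "\<Phi> (\<rho> *\<^sub>R e) * ?V \<le> u 1 0"
  proof -
    have "(LINT y|lebesgue. \<Phi> (\<rho> *\<^sub>R e) * u0 y) \<le> (LINT y|lebesgue. Z 1 (0 - y) * u0 y)"
    proof (rule integral_mono[OF iA iZ])
      fix y
      show "\<Phi> (\<rho> *\<^sub>R e) * u0 y \<le> Z 1 (0 - y) * u0 y"
      proof (cases "y \<in> A")
        case True
        then have d: "norm (y - y0) < 1 / 16" by (simp add: A_def dist_norm norm_minus_commute)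
        have ny0: "norm y0 = \<rho> - 1 / 16" using \<rho> e by (simp add: y0_def)
        have "norm y \<le> \<rho>" using norm_triangle_ineq[of "y - y0" y0] d ny0 by simp
        moreover have "y \<noteq> 0" using d ny0 \<rho> by auto
        ultimately have "\<Phi> (\<rho> *\<^sub>R e) \<le> \<Phi> (- y)" using e \<rho> by (intro anti) auto
        then show ?thesis using scaling[of 1 "- y"] \<open>y \<noteq> 0\<close> True by (simp add: u0_def)
      qed (simp add: u0_def)
    qed simp
    then show ?thesis unfolding LV by (simp add: u_def)
  qed
  have upper: "u s ?x2 \<le> \<Phi> ((\<rho> + 1 / 16) *\<^sub>R e) * ?V"
  proof -
    have sk: "1 \<le> s powr \<kappa>" "0 < s powr \<kappa>" using s \<kappa> by (auto simp: ge_one_powr_ge_zero)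
    have "(LINT y|lebesgue. Z s (?x2 - y) * u0 y) \<le> (LINT y|lebesgue. \<Phi> ((\<rho> + 1 / 16) *\<^sub>R e) * u0 y)"
    proof (rule integral_mono[OF iZ iA])
      fix y
      show "Z s (?x2 - y) * u0 y \<le> \<Phi> ((\<rho> + 1 / 16) *\<^sub>R e) * u0 y"
      proof (cases "y \<in> A")
        case True
        then have d: "norm (y - y0) < 1 / 16" by (simp add: A_def dist_norm norm_minus_commute)
        have "?x2 - y0 = (\<rho> + 3 / 16) *\<^sub>R e" by (simp add: y0_def algebra_simps flip: scaleR_add_left)
        then have "norm (?x2 - y0) = \<rho> + 3 / 16" using \<rho> e by simp
        then have n: "\<rho> + 1 / 8 \<le> norm (?x2 - y)"
          using norm_triangle_ineq[of "?x2 - y" "y - y0"] d by simp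
        then have ne: "?x2 - y \<noteq> 0" using \<rho> by auto
        have "s powr \<kappa> * (\<rho> + 1 / 16) \<le> norm (?x2 - y)" using n \<rho> by linarith
        then have "\<rho> + 1 / 16 \<le> norm (?x2 - y) / s powr \<kappa>"
          using sk by (simp add: pos_le_divide_eq mult.commute)
        then have "norm ((\<rho> + 1 / 16) *\<^sub>R e) \<le> norm ((1 / s powr \<kappa>) *\<^sub>R (?x2 - y))"
          using e \<rho> sk unfolding norm_scaleR by simp
        then have "\<Phi> ((1 / s powr \<kappa>) *\<^sub>R (?x2 - y)) \<le> \<Phi> ((\<rho> + 1 / 16) *\<^sub>R e)"
          using e \<rho> by (intro anti) auto
        moreover have "(1 / (s powr \<kappa>) ^ CARD('d)) * \<Phi> ((1 / s powr \<kappa>) *\<^sub>R (?x2 - y))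
            \<le> 1 * \<Phi> ((1 / s powr \<kappa>) *\<^sub>R (?x2 - y))"
          using sk pos[of "(1 / s powr \<kappa>) *\<^sub>R (?x2 - y)"] ne by (intro mult_right_mono) (auto simp: one_le_power)
        ultimately show ?thesis using scaling[of s "?x2 - y"] ne s True by (simp add: u0_def)
      qed (simp add: u0_def)
    qed (use s in simp)
    then show ?thesis unfolding LV using s by (simp add: u_def)
  qed
  \<comment> \<open>The inequality itself forces the sign, because the solution is positive at time \<open>1\<close>.\<close>
  have "0 \<le> C s"
  proof (rule ccontr)
    assume "\<not> 0 \<le> C s"
    moreover have "0 \<le> u s ?x2"
      unfolding u_def using s nn by (auto intro!: Bochner_Integration.integral_nonneg mult_nonneg_nonneg simp: u0_def)
    ultimately have "C s * u s ?x2 \<le> 0" by (simp add: mult_nonpos_nonneg)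
    moreover have "0 < \<Phi> (\<rho> *\<^sub>R e) * ?V"
      using V e \<rho> by (intro mult_pos_pos pos) auto
    ultimately show False using main lower by simp
  qed
  then have "\<Phi> (\<rho> *\<^sub>R e) * ?V \<le> C s * (\<Phi> ((\<rho> + 1 / 16) *\<^sub>R e) * ?V)"
    using lower main mult_left_mono[OF upper] by fastforce
  then show ?thesis using V by (simp flip: mult.assoc)
qed

lemma harnack_constant_blowup:
  fixes Z :: "real \<Rightarrow> real ^ 'd::finite \<Rightarrow> real" and \<Phi> :: "real ^ 'd \<Rightarrow> real"
  assumes H: "harnack_constant \<alpha> \<beta> Z C" and \<kappa>: "0 < \<kappa>"
    and nn: "\<And>t x. 0 < t \<Longrightarrow> 0 \<le> Z t x"
    and int: "\<And>t. 0 < t \<Longrightarrow> integrable lborel (Z t)"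
    and scaling: "\<And>t x. 0 < t \<Longrightarrow> x \<noteq> 0 \<Longrightarrow> Z t x = (1 / (t powr \<kappa>) ^ CARD('d)) * \<Phi> ((1 / t powr \<kappa>) *\<^sub>R x)"
    and anti: "\<And>a b. a \<noteq> 0 \<Longrightarrow> norm a \<le> norm b \<Longrightarrow> \<Phi> b \<le> \<Phi> a"
    and pos: "\<And>a. a \<noteq> 0 \<Longrightarrow> 0 < \<Phi> a"
    and decay: "\<And>y. 0 \<le> y \<Longrightarrow> \<exists>K. \<forall>a. 1 \<le> norm a \<longrightarrow> \<Phi> a \<le> K * exp (- y * norm a)"
  shows "filterlim C at_top (at_right 1)"
  unfolding filterlim_at_top
proof
  fix M :: real
  obtain e :: "real ^ 'd" where e: "norm e = 1" using vector_choose_size[of 1] by auto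
  define f where "f r = \<Phi> (r *\<^sub>R e)" for r
  have fpos: "0 < f r" if "1 \<le> r" for r unfolding f_def using that e by (intro pos) auto
  have "\<exists>r\<ge>1. M * f (r + 1 / 16) < f r"
  proof (rule superexponential_ratio_unbounded[OF fpos])
    fix y :: real assume "0 \<le> y"
    then obtain K where K: "\<And>a. 1 \<le> norm a \<Longrightarrow> \<Phi> a \<le> K * exp (- y * norm a)" using decay by blast
    have "f r \<le> K * exp (- y * r)" if "1 \<le> r" for r
      using K[of "r *\<^sub>R e"] that e by (simp add: f_def)
    then show "\<exists>C. \<forall>r\<ge>1. f r \<le> C * exp (- y * r)" by blast
  qed auto
  then obtain \<rho> where \<rho>: "1 \<le> \<rho>" "M * f (\<rho> + 1 / 16) < f \<rho>" by blast
  have "((\<lambda>s. s powr \<kappa> * (\<rho> + 1 / 16)) \<longlongrightarrow> 1 powr \<kappa> * (\<rho> + 1 / 16)) (at_right 1)"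
    by (intro tendsto_intros) auto
  then have "\<forall>\<^sub>F s in at_right 1. s powr \<kappa> * (\<rho> + 1 / 16) < \<rho> + 1 / 8"
    by (rule order_tendstoD) simp
  moreover have "\<forall>\<^sub>F s in at_right 1. s < (2::real)" by (rule eventually_at_right_real[of 1 2, THEN eventually_mono]) auto
  moreover have "\<forall>\<^sub>F s in at_right 1. (1::real) < s" by (rule eventually_at_right_less)
  ultimately show "\<forall>\<^sub>F s in at_right 1. M \<le> C s"
  proof eventually_elim
    case (elim s)
    have "f \<rho> \<le> C s * f (\<rho> + 1 / 16)"
      unfolding f_def
      by (rule harnack_constant_kernel[OF H \<kappa> nn int scaling anti pos e]) (use elim \<rho> in auto)
    then have "M * f (\<rho> + 1 / 16) < C s * f (\<rho> + 1 / 16)" using \<rho>(2) by linarith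
    then show ?case using fpos[of "\<rho> + 1 / 16"] \<rho>(1) by (simp add: mult_less_cancel_right)
  qed
qed

section \<open>The Harnack inequality for mild solutions\<close>

theorem theorem2p7:
  fixes \<alpha> \<beta> :: real
  assumes "0 < \<alpha>" and "\<alpha> \<le> 1" and "0 < \<beta>" and "\<beta> \<le> 2"
    and "(\<alpha> \<noteq> 1 \<and> CARD('d::finite) = 1 \<and> 1 < \<beta>) \<or> (\<alpha> = 1 \<and> \<beta> \<noteq> 2)"
  shows "\<exists>C :: real \<Rightarrow> real. (\<forall>s>1. 0 < C s) \<and>
           (\<forall>Z :: real \<Rightarrow> real ^ 'd \<Rightarrow> real. fundamental_solution \<alpha> \<beta> Z \<longrightarrow>
              harnack_constant \<alpha> \<beta> Z C \<and>
              (\<beta> = 2 \<longrightarrow>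
                (\<forall>C'. harnack_constant \<alpha> \<beta> Z C' \<longrightarrow> filterlim C' at_top (at_right 1))))"
proof (cases "\<exists>Z0 :: real \<Rightarrow> real ^ 'd \<Rightarrow> real. fundamental_solution \<alpha> \<beta> Z0")
  case False
  \<comment> \<open>Without a fundamental solution any positive function serves as \<open>C\<close>.\<close>
  then show ?thesis by (intro exI[of _ "\<lambda>_. 1"]) auto
next
  case True
  then obtain Z0 :: "real \<Rightarrow> real ^ 'd \<Rightarrow> real" where Z0: "fundamental_solution \<alpha> \<beta> Z0" by blast
  define \<Phi> where "\<Phi> = Z0 1"
  have \<Phi>: "has_symbol \<Phi> (diffusion_symbol \<alpha> \<beta> 1)"
    unfolding \<Phi>_def by (rule fundamental_solution_symbol[OF Z0]) simp
  note cm = diffusion_symbol_cm[OF assms(1-4), of 1]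
  define \<kappa> where "\<kappa> = \<alpha> / \<beta>"
  have \<kappa>: "0 < \<kappa>" using assms by (simp add: \<kappa>_def)
  have scaling: "Z t x = (1 / (t powr \<kappa>) ^ CARD('d)) * \<Phi> ((1 / t powr \<kappa>) *\<^sub>R x)"
    if "fundamental_solution \<alpha> \<beta> Z" "0 < t" "x \<noteq> 0" for Z t x
    unfolding \<Phi>_def \<kappa>_def by (rule fundamental_solution_scaling[OF assms(1,3) that(1) Z0 that(2,3)])
  have anti: "\<Phi> b \<le> \<Phi> a" if "a \<noteq> 0" "norm a \<le> norm b" for a b
    by (rule symbol_antimono[OF \<Phi> cm that])
  have pos: "0 < \<Phi> a" if "a \<noteq> 0" for a
    by (rule symbol_pos[OF \<Phi> cm _ that]) simp
  obtain B where bound: "\<And>a. a \<noteq> 0 \<Longrightarrow> \<Phi> a \<le> B"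
    using symbol_bounded[OF \<Phi> cm diffusion_symbol_integrable[OF assms]] by blast
  obtain e :: "real ^ 'd" where e: "norm e = 1" using vector_choose_size[of 1] by auto
  define C where "C s = (s powr \<kappa>) ^ CARD('d) * (1 + B / \<Phi> ((1 / (s powr \<kappa> - 1)) *\<^sub>R e))" for s
  have "0 < C s" if s: "1 < s" for s
  proof -
    have "1 < s powr \<kappa>" using s \<kappa> by simp
    then have "(1 / (s powr \<kappa> - 1)) *\<^sub>R e \<noteq> 0" using e by auto
    from pos[OF this] bound[OF this] have "0 < 1 + B / \<Phi> ((1 / (s powr \<kappa> - 1)) *\<^sub>R e)"
      by (intro add_pos_nonneg) auto
    then show ?thesis unfolding C_def using s by simp
  qed
  moreover have "harnack_constant \<alpha> \<beta> Z C" if Z: "fundamental_solution \<alpha> \<beta> Z" for Z :: "real \<Rightarrow> real ^ 'd \<Rightarrow> real"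
    unfolding C_def[abs_def]
    by (rule harnack_constantI[OF assms(1,3)], fold \<kappa>_def,
        rule harnack_kernel[OF \<kappa> scaling[OF Z] anti pos bound e]) auto
  moreover have "filterlim C' at_top (at_right 1)"
    if Z: "fundamental_solution \<alpha> \<beta> Z" and \<beta>: "\<beta> = 2" and H: "harnack_constant \<alpha> \<beta> Z C'"
    for Z :: "real \<Rightarrow> real ^ 'd \<Rightarrow> real" and C'
  proof (rule harnack_constant_blowup[OF H \<kappa> _ _ scaling[OF Z] anti pos])
    fix t :: real assume t: "0 < t"
    show "0 \<le> Z t x" for x by (rule has_symbolD(1)[OF fundamental_solution_symbol[OF Z t]])
    show "integrable lborel (Z t)" by (rule has_symbolD(2)[OF fundamental_solution_symbol[OF Z t]])
  next
    fix y :: real assume y: "0 \<le> y"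
    have "has_symbol \<Phi> (\<lambda>l. mittag_leffler \<alpha> (- l))"
      by (rule has_symbol_cong[OF \<Phi>]) (simp add: diffusion_symbol_def \<beta>)
    then show "\<exists>K. \<forall>a. 1 \<le> norm a \<longrightarrow> \<Phi> a \<le> K * exp (- y * norm a)"
      by (rule symbol_decay[OF _ cm_mittag_leffler[OF assms(1,2)] y])
  qed
  ultimately show ?thesis by blast
qed

end
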